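(* Fix an integer $d\ge 1$. There are constants $0<a\le b$ depending only on $d$ such that the maximum degree $\Delta(G_n)$ of the $d$-NN tree $G_n$ satisfies $$\mathbb P\big(a\log n\le \Delta(G_n)\le b\log n\big)\ge 1-n^{-\omega(1)},$$ i.e. for every $A>0$ the probability of the complementary event is at most $n^{-A}$ for all sufficiently large $n$.
   Context: Here $\log$ is the natural logarithm. Let $\mathbb T^d_n$ be the $d$-dimensional torus of volume $n$ (that is, $\mathbb R^d/(n^{1/d}\mathbb Z)^d$) with the metric inherited from the Euclidean metric. The $d$-NN tree $G_n$: vertices $0,1,\dots,n-1$ arrive one by one, vertex $i$ being placed at a uniformly random point of $\mathbb T^d_n$, independently of all others; each vertex $i\ge 1$ is connected upon arrival by an edge to the closest vertex among $\{0,\dots,i-1\}$ in the torus metric (ties have probability $0$). *)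

theory Defs
  imports "HOL-Probability.Probability"
begin

text \<open>The dimension \<open>d\<close> is \<open>CARD('d)\<close>. Points of the torus
  \<open>\<real>\<^sup>d / (s \<int>)\<^sup>d\<close> of side \<open>s\<close> are given by representatives in \<open>real ^ 'd\<close>;
  \<open>torus_class s x\<close> is the point represented by \<open>x\<close>.\<close>

definition torus_class :: "real \<Rightarrow> real ^ 'd \<Rightarrow> (real ^ 'd) set" where
  "torus_class s x = {x + s *\<^sub>R k | k. \<forall>i. k $ i \<in> \<int>}"

text \<open>The quotient metric: the Euclidean distance between the two classes.\<close>

definition torus_dist :: "real \<Rightarrow> real ^ 'd \<Rightarrow> real ^ 'd \<Rightarrow> real" where
  "torus_dist s x y = setdist (torus_class s x) (torus_class s y)"

definition torus_cell :: "real \<Rightarrow> (real ^ 'd) set" where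
  "torus_cell s = {x. \<forall>i. 0 \<le> x $ i \<and> x $ i < s}"

text \<open>The side length for which the torus has volume \<open>n\<close>.\<close>

definition torus_side :: "'d::finite itself \<Rightarrow> nat \<Rightarrow> real" where
  "torus_side _ n = real n powr (1 / real CARD('d))"

text \<open>The joint law of the positions of the vertices \<open>0, \<dots>, n - 1\<close>. A uniform point of the torus
  is represented by a uniform point of the fundamental cell.\<close>

definition vertex_positions :: "nat \<Rightarrow> (nat \<Rightarrow> real ^ 'd) measure" where
  "vertex_positions n =
     (\<Pi>\<^sub>M i\<in>{..<n}. uniform_measure lborel (torus_cell (torus_side TYPE('d) n)))"

text \<open>\<open>nn_parent s x i\<close> is the closest vertex to \<open>i\<close> among \<open>0, \<dots>, i - 1\<close>. Ties, which almost surely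
  do not occur, are broken in favour of the smallest index. Meaningful for \<open>i \<ge> 1\<close> only.\<close>

definition nn_parent :: "real \<Rightarrow> (nat \<Rightarrow> real ^ 'd) \<Rightarrow> nat \<Rightarrow> nat" where
  "nn_parent s x i =
     (LEAST j. is_arg_min (\<lambda>j. torus_dist s (x i) (x j)) (\<lambda>j. j < i) j)"

definition nn_tree_edges :: "nat \<Rightarrow> (nat \<Rightarrow> real ^ 'd) \<Rightarrow> nat set set" where
  "nn_tree_edges n x = {{i, nn_parent (torus_side TYPE('d) n) x i} | i. 1 \<le> i \<and> i < n}"

definition vertex_degree :: "'v set set \<Rightarrow> 'v \<Rightarrow> nat" where
  "vertex_degree E v = card {e \<in> E. v \<in> e}"

definition max_degree :: "'v set \<Rightarrow> 'v set set \<Rightarrow> nat" where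
  "max_degree V E = Max (vertex_degree E ` V)"

definition nn_tree_max_degree :: "nat \<Rightarrow> (nat \<Rightarrow> real ^ 'd) \<Rightarrow> nat" where
  "nn_tree_max_degree n x = max_degree {..<n} (nn_tree_edges n x)"

end

theory Submission
  imports Defs "HOL-Real_Asymp.Real_Asymp"
begin

text \<open>\<^emph>\<open>Upper bound.\<close> If \<open>i < j\<close> are children of \<open>v\<close>, then \<open>j\<close> is no closer to \<open>i\<close> than to \<open>v\<close>. Hence the
  displacements of children at comparable distance from \<open>v\<close> are separated at the scale of that distance,
  and each dyadic annulus around \<open>v\<close> contains a bounded number of children. Only \<open>O(log n)\<close> annuli have
  radius between \<open>1 / n\<close> and the diameter, and with overwhelming probability no ball of radius of
  order \<open>1 / n\<close> contains \<open>log n\<close> vertices.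

  \<^emph>\<open>Lower bound.\<close> Take about \<open>n\<^sup>\<epsilon>\<close> disjoint balls of equal volume. In each of them look at consecutive
  blocks of \<open>L\<^sup>k\<close> arrivals, \<open>k = 0, \<dots>, K\<close>, where \<open>L = 8\<^sup>d\<close>, and at the concentric balls of volume
  fraction \<open>1 / L\<^sup>k\<close>. If the first arrival is in the innermost ball and, for each \<open>k \<ge> 1\<close>, the
  \<open>k\<close>-th block hits a shell inside the \<open>k\<close>-th ball but no other part of that ball, then the first
  arrival gains a child in each later block. This has probability at least \<open>q ^ (K + 1)\<close> for a
  constant \<open>q > 0\<close>, that is, at least \<open>n\<close> to a small negative power if \<open>K = a log n\<close> with small \<open>a\<close>. Given which vertices fall into which ball,
  the balls are independent, so that all of them fail with superpolynomially small probability only.\<close>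

section \<open>The torus metric and the nearest neighbour tree\<close>

definition torus_lattice :: "real \<Rightarrow> (real ^ 'd) set" where
  "torus_lattice s = torus_class s 0"

lemma torus_lattice_iff: "l \<in> torus_lattice s \<longleftrightarrow> (\<exists>k. (\<forall>i. k $ i \<in> \<int>) \<and> l = s *\<^sub>R k)"
  by (auto simp: torus_lattice_def torus_class_def)

lemma torus_lattice_zero [simp]: "0 \<in> torus_lattice s"
  unfolding torus_lattice_iff by (rule exI[of _ 0]) simp

lemma torus_lattice_diff: "l \<in> torus_lattice s \<Longrightarrow> l' \<in> torus_lattice s \<Longrightarrow> l - l' \<in> torus_lattice s"
  unfolding torus_lattice_iff by (metis Ints_diff scaleR_diff_right vector_minus_component)

lemma torus_class_eq: "torus_class s x = (+) x ` torus_lattice s"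
  unfolding torus_lattice_def torus_class_def by auto

text \<open>Two representatives \<open>x + l\<close> and \<open>y + l'\<close> differ by
  \<open>x - y\<close> minus a lattice vector, because the lattice is closed under differences. The
  distance between two classes thus becomes a function of a single vector, which gives continuity,
  the triangle inequality and the existence of a closest translate.\<close>

lemma torus_dist_eq_infdist:
  fixes x y :: "real ^ 'a"
  shows "torus_dist s x y = infdist (x - y) (torus_lattice s)"
proof (rule antisym)
  show "torus_dist s x y \<le> infdist (x - y) (torus_lattice s)"
    unfolding infdist_eq_setdist
  proof (rule le_setdistI)
    show "torus_lattice s \<noteq> {}"
      using torus_lattice_zero by blast
    fix z l :: "real ^ 'a" assume "z \<in> {x - y}" "l \<in> torus_lattice s"
    moreover have "dist (x - y) l = dist x (y + l)"
      by (simp add: dist_norm algebra_simps)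
    moreover have "x \<in> torus_class s x"
      unfolding torus_class_eq using torus_lattice_zero image_iff by fastforce
    ultimately show "torus_dist s x y \<le> dist z l"
      unfolding torus_dist_def by (auto intro!: setdist_le_dist simp: torus_class_eq)
  qed auto
next
  show "infdist (x - y) (torus_lattice s) \<le> torus_dist s x y"
    unfolding torus_dist_def
  proof (rule le_setdistI)
    show "torus_class s x \<noteq> {}" "torus_class s y \<noteq> {}"
      unfolding torus_class_eq using torus_lattice_zero by blast+
    fix x' y' assume "x' \<in> torus_class s x" "y' \<in> torus_class s y"
    then obtain l l' where l: "l \<in> torus_lattice s" "l' \<in> torus_lattice s" "x' = x + l" "y' = y + l'"
      by (auto simp: torus_class_eq)
    have "infdist (x - y) (torus_lattice s) \<le> dist (x - y) (l' - l)"
      by (intro infdist_le torus_lattice_diff l)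
    also have "\<dots> = dist x' y'"
      by (simp add: l dist_norm algebra_simps)
    finally show "infdist (x - y) (torus_lattice s) \<le> dist x' y'" .
  qed
qed

text \<open>Distinct lattice points differ by at least \<open>s\<close> in some coordinate, so the
  lattice is uniformly discrete. Closedness turns the infimum in the torus distance into a
  minimum.\<close>

lemma closed_torus_lattice:
  assumes "s > 0"
  shows "closed (torus_lattice s :: (real ^ 'd) set)"
proof (rule discrete_imp_closed[OF assms], intro ballI impI)
  fix x y :: "real ^ 'd" assume xy: "x \<in> torus_lattice s" "y \<in> torus_lattice s" "dist y x < s"
  then obtain k where k: "\<forall>i. k $ i \<in> \<int>" "y - x = s *\<^sub>R k"
    using torus_lattice_diff torus_lattice_iff by metis
  have "k $ i = 0" for i
  proof (rule ccontr)
    assume "k $ i \<noteq> 0"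
    then have "1 \<le> \<bar>k $ i\<bar>"
      using k(1) Ints_nonzero_abs_ge1 by blast
    then have "s \<le> \<bar>(y - x) $ i\<bar>"
      using assms by (simp add: k(2) abs_mult del: vector_minus_component)
    also have "\<dots> \<le> norm (y - x)"
      by (rule component_le_norm_cart)
    finally show False
      using xy(3) by (simp add: dist_norm)
  qed
  then have "k = 0"
    by (simp add: vec_eq_iff)
  then show "y = x"
    using k(2) by simp
qed

lemma torus_dist_le: "l \<in> torus_lattice s \<Longrightarrow> torus_dist s x y \<le> norm (x - y - l)"
  unfolding torus_dist_eq_infdist by (metis dist_norm infdist_le)

lemma torus_dist_attained:
  assumes "s > 0"
  obtains l where "l \<in> torus_lattice s" "torus_dist s x y = norm (x - y - l)"
  using infdist_attains_inf[OF closed_torus_lattice[OF assms], of "x - y"] torus_lattice_zero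
  unfolding torus_dist_eq_infdist dist_norm by blast

text \<open>The cell is half open, so coordinates of two of its points differ by less than
  \<open>s\<close>, whereas a nonzero lattice vector has a coordinate of absolute value at least
  \<open>s\<close>.\<close>

lemma torus_cell_translate:
  assumes "y \<in> torus_cell s" "y + l \<in> torus_cell s" "l \<in> torus_lattice s"
  shows "l = 0"
proof -
  obtain k where k: "\<forall>i. k $ i \<in> \<int>" "l = s *\<^sub>R k"
    using assms(3) torus_lattice_iff by blast
  have "k $ i = 0" for i
  proof (rule ccontr)
    assume "k $ i \<noteq> 0"
    then have k1: "1 \<le> \<bar>k $ i\<bar>"
      using k(1) Ints_nonzero_abs_ge1 by blast
    have b: "0 \<le> y $ i" "y $ i < s" "0 \<le> y $ i + s * k $ i" "y $ i + s * k $ i < s"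
      using assms(1,2) by (auto simp: torus_cell_def k(2))
    then have "\<bar>s * k $ i\<bar> < s"
      by linarith
    moreover have "s > 0"
      using b by linarith
    ultimately show False
      using k1 by (auto simp: abs_mult)
  qed
  then show ?thesis
    using k(2) by (simp add: vec_eq_iff)
qed

section \<open>Nearest neighbours, children and degrees\<close>

lemma nn_parent_eqI:
  assumes "v < i" "\<And>u. u < i \<Longrightarrow> u \<noteq> v \<Longrightarrow> torus_dist s (x i) (x v) < torus_dist s (x i) (x u)"
  shows "nn_parent s x i = v"
  unfolding nn_parent_def is_arg_min_def
proof (rule Least_equality)
  show "v < i \<and> \<not> (\<exists>y<i. torus_dist s (x i) (x y) < torus_dist s (x i) (x v))"
    using assms by (metis order_less_asym order_less_irrefl)
  fix u assume "u < i \<and> \<not> (\<exists>y<i. torus_dist s (x i) (x y) < torus_dist s (x i) (x u))"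
  then show "v \<le> u"
    using assms by (metis order_refl)
qed

lemma nn_parent_minimal:
  assumes "i \<ge> 1"
  shows "nn_parent s x i < i" "u < i \<Longrightarrow> torus_dist s (x i) (x (nn_parent s x i)) \<le> torus_dist s (x i) (x u)"
proof -
  have "\<exists>j. is_arg_min (\<lambda>j. torus_dist s (x i) (x j)) (\<lambda>j. j < i) j"
    using ex_is_arg_min_if_finite[of "{..<i}" "\<lambda>j. torus_dist s (x i) (x j)"] assms
    by (simp add: lessThan_empty_iff Suc_le_eq)
  from LeastI_ex[OF this] have "is_arg_min (\<lambda>j. torus_dist s (x i) (x j)) (\<lambda>j. j < i) (nn_parent s x i)"
    unfolding nn_parent_def .
  then show "nn_parent s x i < i" "u < i \<Longrightarrow> torus_dist s (x i) (x (nn_parent s x i)) \<le> torus_dist s (x i) (x u)"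
    unfolding is_arg_min_def by (blast, meson not_less)
qed

text \<open>Index \<open>0\<close> is left out because the value of \<open>nn_parent\<close> there
  is an unspecified default.\<close>

definition nn_children :: "nat \<Rightarrow> (nat \<Rightarrow> real ^ 'd) \<Rightarrow> nat \<Rightarrow> nat set" where
  "nn_children n x v = {i. 1 \<le> i \<and> i < n \<and> nn_parent (torus_side TYPE('d) n) x i = v}"

lemma finite_nn_children [simp]: "finite (nn_children n x v)"
  by (rule finite_subset[of _ "{..<n}"]) (auto simp: nn_children_def)

lemma finite_nn_tree_edges [simp]: "finite (nn_tree_edges n x)"
  by (rule finite_surj[of "{..<n}"]) (auto simp: nn_tree_edges_def)

lemma vertex_degree_le_children:
  fixes x :: "nat \<Rightarrow> real ^ 'd"
  shows "vertex_degree (nn_tree_edges n x) v \<le> 1 + card (nn_children n x v)"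
proof -
  let ?p = "nn_parent (torus_side TYPE('d) n) x"
  \<comment> \<open>An edge at \<open>v\<close> leads to the parent of \<open>v\<close> or to a
    child. For \<open>v = 0\<close> the value \<open>?p v\<close> is unspecified, and inserting one
    more set only enlarges the right-hand side.\<close>
  have "{e \<in> nn_tree_edges n x. v \<in> e} \<subseteq> insert {v, ?p v} ((\<lambda>i. {i, v}) ` nn_children n x v)"
    by (auto simp: nn_tree_edges_def nn_children_def)
  then have "vertex_degree (nn_tree_edges n x) v \<le> card (insert {v, ?p v} ((\<lambda>i. {i, v}) ` nn_children n x v))"
    unfolding vertex_degree_def by (intro card_mono) auto
  also have "\<dots> \<le> Suc (card ((\<lambda>i. {i, v}) ` nn_children n x v))"
    by (rule card_insert_le_m1) auto
  also have "\<dots> \<le> 1 + card (nn_children n x v)"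
    by (simp add: card_image_le)
  finally show ?thesis .
qed

lemma card_children_le_vertex_degree:
  assumes "C \<subseteq> nn_children n x v"
  shows "card C \<le> vertex_degree (nn_tree_edges n x) v"
proof -
  have lt: "v < i" if "i \<in> C" for i
    using that assms nn_parent_minimal(1)[of i] by (fastforce simp: nn_children_def)
  have "inj_on (\<lambda>i. {i, v}) C"
    by (rule inj_onI) (use lt in \<open>auto simp: doubleton_eq_iff\<close>)
  then have "card C = card ((\<lambda>i. {i, v}) ` C)"
    by (simp add: card_image)
  also have "\<dots> \<le> vertex_degree (nn_tree_edges n x) v"
    unfolding vertex_degree_def using assms
    by (intro card_mono) (auto simp: nn_tree_edges_def nn_children_def)
  finally show ?thesis .
qed

lemma max_degree_ge:
  assumes "v < n"
  shows "vertex_degree (nn_tree_edges n x) v \<le> nn_tree_max_degree n x"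
  using assms unfolding nn_tree_max_degree_def max_degree_def by (intro Max_ge) auto

section \<open>Counting the children at distance at least \<open>r\<close>\<close>

lemma norm_diff_less_of_floor_eq:
  fixes a b :: "real ^ 'd"
  assumes "t > 0" and fl: "\<And>c. \<lfloor>a $ c * CARD('d) / t\<rfloor> = \<lfloor>b $ c * CARD('d) / t\<rfloor>"
  shows "norm (a - b) < t"
proof -
  \<comment> \<open>Equal floors put both coordinates into one grid interval of width
    \<open>t / CARD('d)\<close>. Summing over the coordinates bounds the l1 norm, hence the
    Euclidean norm, by \<open>t\<close>.\<close>
  have "\<bar>(a - b) $ c\<bar> < t / CARD('d)" for c
  proof -
    have "\<bar>a $ c * CARD('d) / t - b $ c * CARD('d) / t\<bar> < 1"
      using fl[of c] by linarith
    also have "a $ c * CARD('d) / t - b $ c * CARD('d) / t = (a - b) $ c * (CARD('d) / t)"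
      by (simp add: diff_divide_distrib left_diff_distrib)
    finally show ?thesis
      using assms(1) by (simp add: abs_mult pos_less_divide_eq pos_divide_less_eq del: vector_minus_component)
  qed
  then have "(\<Sum>c\<in>UNIV. \<bar>(a - b) $ c\<bar>) < (\<Sum>c\<in>(UNIV :: 'd set). t / CARD('d))"
    by (intro sum_strict_mono) auto
  also have "\<dots> = t"
    by simp
  finally show ?thesis
    using norm_le_l1_cart[of "a - b"] by linarith
qed

text \<open>The displacements of the far children are pairwise separated at their own scale:
  classifying them by dyadic scale and by a grid cell of proportional width is injective.\<close>

lemma card_far_children_le:
  fixes x :: "nat \<Rightarrow> real ^ 'd" and r s :: real and n :: nat
  defines "s \<equiv> torus_side TYPE('d) n"
  assumes "s > 0" "0 < r" "v < n" and cell: "\<And>i. i < n \<Longrightarrow> x i \<in> torus_cell s"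
    and rs: "r \<le> CARD('d) * s"
  shows "real (card {i \<in> nn_children n x v. r \<le> torus_dist s (x i) (x v)})
    \<le> (log 2 (CARD('d) * s / r) + 2) * (4 * CARD('d)) ^ CARD('d)"
proof -
  let ?d = "real CARD('d)"
  let ?F = "{i \<in> nn_children n x v. r \<le> torus_dist s (x i) (x v)}"
  have "\<exists>l. l \<in> torus_lattice s \<and> torus_dist s (x i) (x v) = norm (x i - x v - l)" for i
    using torus_dist_attained[OF \<open>s > 0\<close>] by metis
  then obtain l where l: "\<And>i. l i \<in> torus_lattice s"
    "\<And>i. torus_dist s (x i) (x v) = norm (x i - x v - l i)"
    by metis
  \<comment> \<open>\<open>a i\<close> is the shortest displacement from \<open>v\<close> to
    \<open>i\<close> on the torus, so its Euclidean norm is the torus distance.\<close>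
  define a where "a i = x i - x v - l i" for i
  have na: "torus_dist s (x i) (x v) = norm (a i)" for i
    by (simp add: a_def l)
  \<comment> \<open>When \<open>j\<close> arrives, \<open>i\<close> is already present, and
    \<open>j\<close> still prefers \<open>v\<close>. The lattice vector \<open>l j - l i\<close>
    need not be optimal for the pair \<open>j\<close>, \<open>i\<close>, but it bounds their torus
    distance from above.\<close>
  have sep: "norm (a j) \<le> norm (a j - a i)" if "i < j" "j \<in> ?F" for i j
  proof -
    have "torus_dist s (x j) (x v) \<le> torus_dist s (x j) (x i)"
      using that nn_parent_minimal(2)[of j i s x] by (auto simp: nn_children_def s_def)
    also have "\<dots> \<le> norm (x j - x i - (l j - l i))"
      by (intro torus_dist_le torus_lattice_diff l)
    also have "x j - x i - (l j - l i) = a j - a i"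
      by (simp add: a_def algebra_simps)
    finally show ?thesis
      by (simp add: na)
  qed
  have upper: "norm (a i) \<le> ?d * s" if "i \<in> ?F" for i
  proof -
    have "norm (a i) \<le> norm (x i - x v)"
      using torus_dist_le[of 0 s "x i" "x v"] by (simp add: na)
    also have "\<dots> \<le> (\<Sum>c\<in>UNIV. \<bar>(x i - x v) $ c\<bar>)"
      by (rule norm_le_l1_cart)
    also have "\<dots> \<le> (\<Sum>c\<in>(UNIV :: 'd set). s)"
    proof (rule sum_mono)
      fix c
      have "0 \<le> x i $ c" "x i $ c < s" "0 \<le> x v $ c" "x v $ c < s"
        using cell[of i] cell[of v] \<open>v < n\<close> that by (auto simp: torus_cell_def nn_children_def)
      then show "\<bar>(x i - x v) $ c\<bar> \<le> s"
        by simp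
    qed
    also have "\<dots> = ?d * s"
      by simp
    finally show ?thesis .
  qed
  have pos: "norm (a i) > 0" if "i \<in> ?F" for i
    using that \<open>0 < r\<close> na[of i] by auto
  \<comment> \<open>\<open>wd i\<close> is the power of two with
    \<open>wd i \<le> norm (a i) < 2 * wd i\<close>, and \<open>g i\<close> is the cell of
    \<open>a i\<close> in a grid of width \<open>wd i / ?d\<close>.\<close>
  define sc where "sc i = \<lfloor>log 2 (norm (a i))\<rfloor>" for i
  define wd where "wd i = 2 powr (real_of_int (sc i))" for i
  define g where "g i = (\<lambda>c. \<lfloor>a i $ c * ?d / wd i\<rfloor>)" for i
  have wd: "wd i > 0" "wd i \<le> norm (a i)" "norm (a i) < 2 * wd i" if "i \<in> ?F" for i
  proof -
    show "wd i > 0"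
      by (simp add: wd_def)
    show "wd i \<le> norm (a i)"
      using pos[OF that] unfolding wd_def sc_def by (subst powr_le_iff) auto
    have "norm (a i) < 2 powr (real_of_int (sc i) + 1)"
      using pos[OF that] unfolding sc_def by (subst less_powr_iff) auto
    then show "norm (a i) < 2 * wd i"
      by (simp add: wd_def powr_add)
  qed
  have inj: "inj_on (\<lambda>i. (sc i, g i)) ?F"
  proof (rule linorder_inj_onI)
    fix i j assume ij: "i < j" "i \<in> ?F" "j \<in> ?F"
    show "(sc i, g i) \<noteq> (sc j, g j)"
    proof
      \<comment> \<open>Same scale and same grid cell would bring the two displacements closer than
        \<open>wd j\<close>, which is at most \<open>norm (a j)\<close>, against
        \<open>sep\<close>.\<close>
      assume eq: "(sc i, g i) = (sc j, g j)"
      then have "wd i = wd j"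
        by (simp add: wd_def)
      then have "norm (a j - a i) < wd j"
        using eq wd(1)[OF ij(3)] by (intro norm_diff_less_of_floor_eq) (auto simp: g_def fun_eq_iff)
      then show False
        using sep[OF ij(1,3)] wd(2)[OF ij(3)] by linarith
    qed
  qed auto
  \<comment> \<open>The scales run from that of \<open>r\<close> to that of the crude diameter bound
    \<open>?d * s\<close>. Since each coordinate of \<open>a i\<close> is below
    \<open>2 * wd i\<close> in absolute value, each grid coordinate takes one of
    \<open>4 * CARD('d)\<close> values.\<close>
  let ?S = "{\<lfloor>log 2 r\<rfloor>..\<lfloor>log 2 (?d * s)\<rfloor>}"
  let ?G = "(UNIV :: 'd set) \<rightarrow>\<^sub>E {-2 * int CARD('d)..<2 * int CARD('d)}"
  have sub: "(\<lambda>i. (sc i, g i)) ` ?F \<subseteq> ?S \<times> ?G"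
  proof (intro image_subsetI SigmaI)
    fix i assume i: "i \<in> ?F"
    then have "r \<le> norm (a i)"
      by (simp add: na)
    then show "sc i \<in> ?S"
      using upper[OF i] pos[OF i] \<open>0 < r\<close> unfolding sc_def by (auto intro!: floor_mono)
    have "g i c \<in> {-2 * int CARD('d)..<2 * int CARD('d)}" for c
    proof -
      have "\<bar>a i $ c\<bar> < 2 * wd i"
        using component_le_norm_cart[of "a i" c] wd(3)[OF i] by linarith
      then have "\<bar>a i $ c * ?d / wd i\<bar> < 2 * ?d"
        using wd(1)[OF i] by (simp add: abs_mult field_simps)
      then have "-2 * ?d \<le> a i $ c * ?d / wd i" "a i $ c * ?d / wd i < 2 * ?d"
        by linarith+
      then show ?thesis
        unfolding g_def by (auto simp: le_floor_iff floor_less_iff)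
    qed
    then show "g i \<in> ?G"
      by auto
  qed
  have "card ?F = card ((\<lambda>i. (sc i, g i)) ` ?F)"
    by (simp add: card_image[OF inj])
  also have "\<dots> \<le> card (?S \<times> ?G)"
    by (intro card_mono sub finite_cartesian_product finite_PiE) auto
  also have "\<dots> = nat (\<lfloor>log 2 (?d * s)\<rfloor> + 1 - \<lfloor>log 2 r\<rfloor>) * (4 * CARD('d)) ^ CARD('d)"
    by (simp add: card_cartesian_product card_funcsetE nat_mult_distrib flip: of_nat_mult)
  finally have "real (card ?F) \<le> real (nat (\<lfloor>log 2 (?d * s)\<rfloor> + 1 - \<lfloor>log 2 r\<rfloor>)) * (4 * ?d) ^ CARD('d)"
    by (metis (mono_tags, lifting) of_nat_le_iff of_nat_mult of_nat_numeral of_nat_power)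
  also have "real (nat (\<lfloor>log 2 (?d * s)\<rfloor> + 1 - \<lfloor>log 2 r\<rfloor>)) \<le> log 2 (?d * s / r) + 2"
  proof -
    have "log 2 r \<le> log 2 (?d * s)"
      using rs \<open>0 < r\<close> by (subst log_le_cancel_iff) auto
    moreover have "log 2 (?d * s / r) = log 2 (?d * s) - log 2 r"
      using rs \<open>0 < r\<close> \<open>0 < s\<close> by (subst log_divide) auto
    ultimately show ?thesis
      by linarith
  qed
  finally show ?thesis
    by (simp add: mult_right_mono)
qed

section \<open>Independent uniform points\<close>

context prob_space
begin

lemma sets_PiM_Collect_const:
  assumes "finite J" "J \<subseteq> I" "\<And>i. i \<in> J \<Longrightarrow> A i \<in> sets M"
  shows "{x \<in> space (PiM I (\<lambda>_. M)). \<forall>i\<in>J. x i \<in> A i} \<in> sets (PiM I (\<lambda>_. M))"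
proof (intro sets.sets_Collect_finite_All assms(1))
  fix i assume i: "i \<in> J"
  have "{x \<in> space (PiM I (\<lambda>_. M)). x i \<in> A i} = (\<lambda>x. x i) -` A i \<inter> space (PiM I (\<lambda>_. M))"
    by auto
  also have "\<dots> \<in> sets (PiM I (\<lambda>_. M))"
    using i assms(2,3) by (intro measurable_sets[OF measurable_component_singleton]) auto
  finally show "{x \<in> space (PiM I (\<lambda>_. M)). x i \<in> A i} \<in> sets (PiM I (\<lambda>_. M))" .
qed

lemma measure_PiM_Collect_const:
  assumes "finite J" "J \<subseteq> I" "\<And>i. i \<in> J \<Longrightarrow> A i \<in> sets M"
  shows "measure (PiM I (\<lambda>_. M)) {x \<in> space (PiM I (\<lambda>_. M)). \<forall>i\<in>J. x i \<in> A i} = (\<Prod>i\<in>J. measure M (A i))"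
proof -
  interpret P: product_prob_space "\<lambda>_. M" I
    by unfold_locales
  show ?thesis
    using P.emeasure_PiM_Collect[OF assms(2,1), of A] assms(3)
    unfolding P.emeasure_eq_measure emeasure_eq_measure by (simp add: prod_ennreal prod_nonneg)
qed

lemma measure_PiM_PiE_const:
  assumes "finite I" "\<And>i. i \<in> I \<Longrightarrow> A i \<in> sets M"
  shows "measure (PiM I (\<lambda>_. M)) (PiE I A) = (\<Prod>i\<in>I. measure M (A i))"
proof -
  interpret P: finite_product_prob_space "\<lambda>_. M" I
    by unfold_locales fact
  show ?thesis
    by (rule P.finite_measure_PiM_emb) (use assms in auto)
qed

text \<open>The coordinates are independent under the product measure, and grouping them along
  disjoint index sets preserves independence. The law of the group \<open>U b\<close> is again a
  product measure, so the joint probability factors.\<close>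

lemma measure_PiM_blocks:
  assumes fin: "finite I" "finite W" and U: "\<And>b. b \<in> W \<Longrightarrow> U b \<subseteq> I" "disjoint_family_on U W"
    and A: "\<And>b. b \<in> W \<Longrightarrow> A b \<in> sets (PiM (U b) (\<lambda>_. M))"
  shows "measure (PiM I (\<lambda>_. M)) {x \<in> space (PiM I (\<lambda>_. M)). \<forall>b\<in>W. restrict x (U b) \<in> A b}
    = (\<Prod>b\<in>W. measure (PiM (U b) (\<lambda>_. M)) (A b))"
proof -
  interpret P: product_prob_space "\<lambda>_. M" I
    by unfold_locales
  have ind: "P.indep_vars (\<lambda>_. M) (\<lambda>i x. x i) I"
  proof (cases "I = {}")
    case True
    then show ?thesis
      unfolding P.indep_vars_def P.indep_sets_def by auto
  next
    case False
    have "distr (PiM I (\<lambda>_. M)) (PiM I (\<lambda>_. M)) (\<lambda>x. \<lambda>i\<in>I. x i) = PiM I (\<lambda>_. M)"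
      using P.distr_PiM_restrict_finite[of I] fin by (simp add: restrict_def)
    moreover have "(\<Pi>\<^sub>M i\<in>I. distr (PiM I (\<lambda>_. M)) M (\<lambda>x. x i)) = PiM I (\<lambda>_. M)"
      by (intro PiM_cong refl P.PiM_component)
    ultimately show ?thesis
      using False by (subst P.indep_vars_iff_distr_eq_PiM') auto
  qed
  show ?thesis
  proof (cases "W = {}")
    case True
    then show ?thesis
      using P.P.prob_space by simp
  next
    case False
    let ?X = "\<lambda>b x. restrict (\<lambda>i. x i) (U b)"
    have "{x \<in> space (PiM I (\<lambda>_. M)). \<forall>b\<in>W. restrict x (U b) \<in> A b}
        = (\<Inter>b\<in>W. ?X b -` A b \<inter> space (PiM I (\<lambda>_. M)))"
      using False by auto
    also have "P.prob \<dots> = (\<Prod>b\<in>W. P.prob (?X b -` A b \<inter> space (PiM I (\<lambda>_. M))))"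
      by (rule P.indep_varsD_finite[OF P.indep_vars_restrict[OF ind U]]) (use False fin A in auto)
    also have "\<dots> = (\<Prod>b\<in>W. measure (PiM (U b) (\<lambda>_. M)) (A b))"
    proof (rule prod.cong[OF refl])
      fix b assume b: "b \<in> W"
      have "measure (PiM (U b) (\<lambda>_. M)) (A b)
          = measure (distr (PiM I (\<lambda>_. M)) (PiM (U b) (\<lambda>_. M)) (\<lambda>x. restrict x (U b))) (A b)"
        using U(1)[OF b] fin finite_subset by (subst P.distr_PiM_restrict_finite) auto
      also have "\<dots> = P.prob (?X b -` A b \<inter> space (PiM I (\<lambda>_. M)))"
        using U(1)[OF b] A[OF b] by (subst measure_distr) (auto intro!: measurable_restrict_subset)
      finally show "P.prob (?X b -` A b \<inter> space (PiM I (\<lambda>_. M))) = measure (PiM (U b) (\<lambda>_. M)) (A b)" ..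
    qed
    finally show ?thesis .
  qed
qed

text \<open>Conditionally on the cells of a finite partition into which the points fall, the point patterns
  in different cells are independent. The proof sums over all ways of assigning points to cells.\<close>

lemma prob_all_cells_fail_le:
  assumes fin: "finite I" "finite W" and C: "\<And>b. b \<in> W \<Longrightarrow> C b \<in> sets M"
    and disj: "disjoint_family_on C W" and cover: "(\<Union>b\<in>W. C b) = space M"
    and "J \<subseteq> W" "p \<le> 1" and D: "D \<in> sets (PiM I (\<lambda>_. M))"
    and succ: "\<And>j T. j \<in> J \<Longrightarrow> T \<subseteq> I \<Longrightarrow> m \<le> card T \<Longrightarrow>
      \<exists>A\<in>sets (PiM T (\<lambda>_. M)). A \<subseteq> (\<Pi>\<^sub>E i\<in>T. C j) \<and>
        p * measure M (C j) ^ card T \<le> measure (PiM T (\<lambda>_. M)) A \<and>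
        (\<forall>x\<in>space (PiM I (\<lambda>_. M)). {i \<in> I. x i \<in> C j} = T \<longrightarrow> restrict x T \<in> A \<longrightarrow> x \<in> D)"
  shows "measure (PiM I (\<lambda>_. M))
    {x \<in> space (PiM I (\<lambda>_. M)). x \<notin> D \<and> (\<forall>j\<in>J. m \<le> card {i \<in> I. x i \<in> C j})} \<le> (1 - p) ^ card J"
proof -
  interpret P: product_prob_space "\<lambda>_. M" I
    by unfold_locales
  let ?P = "PiM I (\<lambda>_. M)"
  \<comment> \<open>A function \<open>f\<close> assigns to each point the cell that it falls into,
    and \<open>U f b\<close> collects the points assigned to \<open>b\<close>.
    \<open>\<Lambda>\<close> keeps the assignments that give every cell of \<open>J\<close> at least
    \<open>m\<close> points.\<close>
  define U where "U f b = {i \<in> I. f i = b}" for f :: "'b \<Rightarrow> 'c" and b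
  define \<Lambda> where "\<Lambda> = {f \<in> I \<rightarrow>\<^sub>E W. \<forall>j\<in>J. m \<le> card (U f j)}"
  have fin\<Lambda>: "finite \<Lambda>" "finite (I \<rightarrow>\<^sub>E W)"
    using fin by (auto simp: \<Lambda>_def intro!: finite_PiE)
  define ok where "ok j T A \<longleftrightarrow> A \<in> sets (PiM T (\<lambda>_. M)) \<and> A \<subseteq> (\<Pi>\<^sub>E i\<in>T. C j) \<and>
    p * measure M (C j) ^ card T \<le> measure (PiM T (\<lambda>_. M)) A \<and>
    (\<forall>x\<in>space ?P. {i \<in> I. x i \<in> C j} = T \<longrightarrow> restrict x T \<in> A \<longrightarrow> x \<in> D)" for j T A
  define A where "A j T = (SOME A. ok j T A)" for j T
  have A: "ok j T (A j T)" if "j \<in> J" "T \<subseteq> I" "m \<le> card T" for j T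
    unfolding A_def by (rule someI_ex) (use succ[OF that] in \<open>auto simp: ok_def\<close>)
  \<comment> \<open>\<open>Q f b\<close> says that the points assigned to \<open>b\<close> do lie in
    \<open>C b\<close> and, if \<open>b \<in> J\<close>, that they miss the success event.
    \<open>E f\<close> combines this over all cells.\<close>
  define Q where "Q f b = (\<Pi>\<^sub>E i\<in>U f b. C b) - (if b \<in> J then A b (U f b) else {})" for f b
  define E where "E f = {x \<in> space ?P. \<forall>b\<in>W. restrict x (U f b) \<in> Q f b}" for f
  have UI: "U f b \<subseteq> I" "finite (U f b)" for f b
    using fin by (auto simp: U_def)
  have boxS: "(\<Pi>\<^sub>E i\<in>U f b. C b) \<in> sets (PiM (U f b) (\<lambda>_. M))" if "b \<in> W" for f b
    using that UI C by (intro sets_PiM_I_finite) auto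
  have QS: "Q f b \<in> sets (PiM (U f b) (\<lambda>_. M))" if "b \<in> W" "f \<in> \<Lambda>" for f b
    using that A[of b "U f b"] UI boxS by (auto simp: Q_def ok_def \<Lambda>_def intro!: sets.Diff)
  have Em: "E f \<in> sets ?P" if "f \<in> \<Lambda>" for f
  proof -
    have "E f = space ?P \<inter> (\<Inter>b\<in>W. (\<lambda>x. restrict x (U f b)) -` Q f b \<inter> space ?P)"
      by (auto simp: E_def)
    also have "\<dots> \<in> sets ?P"
    proof (cases "W = {}")
      case False
      then show ?thesis
        using QS that UI fin
        by (intro sets.Int sets.top sets.finite_INT measurable_sets[OF measurable_restrict_subset]) auto
    qed simp
    finally show ?thesis .
  qed
  \<comment> \<open>A bad configuration belongs to \<open>E f\<close> for the assignment
    \<open>f\<close> that it realises: a success in any cell of \<open>J\<close> would force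
    \<open>x \<in> D\<close>.\<close>
  have sub: "{x \<in> space ?P. x \<notin> D \<and> (\<forall>j\<in>J. m \<le> card {i \<in> I. x i \<in> C j})} \<subseteq> (\<Union>f\<in>\<Lambda>. E f)"
  proof safe
    fix x assume x: "x \<in> space ?P" "x \<notin> D" "\<forall>j\<in>J. m \<le> card {i \<in> I. x i \<in> C j}"
    have "\<exists>b. i \<in> I \<longrightarrow> b \<in> W \<and> x i \<in> C b" for i
      using x(1) cover by (auto simp: space_PiM PiE_iff)
    then obtain f0 where f0: "\<And>i. i \<in> I \<Longrightarrow> f0 i \<in> W \<and> x i \<in> C (f0 i)"
      by metis
    define f where "f = restrict f0 I"
    have f: "f \<in> I \<rightarrow>\<^sub>E W"
      using f0 by (auto simp: f_def)
    have Ueq: "U f b = {i \<in> I. x i \<in> C b}" if "b \<in> W" for b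
    proof -
      have "f i = b \<longleftrightarrow> x i \<in> C b" if "i \<in> I" for i
        using disjoint_family_onD[OF disj, of "f0 i" b] f0[OF that] \<open>b \<in> W\<close> that by (auto simp: f_def)
      then show ?thesis
        by (auto simp: U_def)
    qed
    have "f \<in> \<Lambda>"
      using f x(3) Ueq \<open>J \<subseteq> W\<close> by (auto simp: \<Lambda>_def)
    moreover have "x \<in> E f"
      unfolding E_def
    proof (intro CollectI conjI ballI x(1))
      fix b assume b: "b \<in> W"
      have "restrict x (U f b) \<in> (\<Pi>\<^sub>E i\<in>U f b. C b)"
        by (auto simp: Ueq[OF b])
      moreover have "restrict x (U f b) \<notin> A b (U f b)" if "b \<in> J"
        using A[OF that UI(1)[of f b]] Ueq[OF b] \<open>f \<in> \<Lambda>\<close> that x by (auto simp: \<Lambda>_def ok_def)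
      ultimately show "restrict x (U f b) \<in> Q f b"
        by (auto simp: Q_def)
    qed
    ultimately show "x \<in> (\<Union>f\<in>\<Lambda>. E f)"
      by blast
  qed
  \<comment> \<open>By independence the probability factors over the cells. A cell of
    \<open>J\<close> contributes at most \<open>1 - p\<close> times the probability that its points
    fall into it.\<close>
  have bound: "P.prob (E f) \<le> (1 - p) ^ card J * (\<Prod>i\<in>I. measure M (C (f i)))" if f: "f \<in> \<Lambda>" for f
  proof -
    have "P.prob (E f) = (\<Prod>b\<in>W. measure (PiM (U f b) (\<lambda>_. M)) (Q f b))"
      unfolding E_def using UI QS f fin
      by (intro measure_PiM_blocks) (auto simp: disjoint_family_on_def U_def)
    also have "\<dots> \<le> (\<Prod>b\<in>W. (if b \<in> J then 1 - p else 1) * measure M (C b) ^ card (U f b))"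
    proof (intro prod_mono conjI measure_nonneg)
      fix b assume b: "b \<in> W"
      interpret Pb: product_prob_space "\<lambda>_. M" "U f b"
        by unfold_locales
      have box: "Pb.prob (\<Pi>\<^sub>E i\<in>U f b. C b) = measure M (C b) ^ card (U f b)"
        using C[OF b] UI by (subst measure_PiM_PiE_const) auto
      show "Pb.prob (Q f b) \<le> (if b \<in> J then 1 - p else 1) * measure M (C b) ^ card (U f b)"
      proof (cases "b \<in> J")
        case True
        note Ab = A[OF True UI(1)[of f b], unfolded ok_def]
        have m: "m \<le> card (U f b)"
          using f True by (auto simp: \<Lambda>_def)
        have "Pb.prob (Q f b) = Pb.prob (\<Pi>\<^sub>E i\<in>U f b. C b) - Pb.prob (A b (U f b))"
          using Ab m True boxS[OF b] by (auto simp: Q_def intro!: Pb.finite_measure_Diff)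
        also have "\<dots> \<le> measure M (C b) ^ card (U f b) - p * measure M (C b) ^ card (U f b)"
          using Ab m by (simp add: box)
        finally show ?thesis
          using True by (simp add: algebra_simps)
      next
        case False
        then show ?thesis
          by (simp add: Q_def box)
      qed
    qed
    also have "\<dots> = (\<Prod>b\<in>W. if b \<in> J then 1 - p else 1) * (\<Prod>b\<in>W. \<Prod>i\<in>U f b. measure M (C (f i)))"
      unfolding prod.distrib by (intro arg_cong2[where f = "(*)"] prod.cong refl) (simp add: U_def)
    also have "(\<Prod>b\<in>W. if b \<in> J then 1 - p else 1) = (1 - p) ^ card J"
      using \<open>J \<subseteq> W\<close> fin by (simp add: prod.If_cases Int_absorb1)
    also have "(\<Prod>b\<in>W. \<Prod>i\<in>U f b. measure M (C (f i))) = (\<Prod>i\<in>I. measure M (C (f i)))"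
      unfolding U_def using f fin by (intro prod.group) (auto simp: \<Lambda>_def)
    finally show ?thesis .
  qed
  have "(\<Sum>b\<in>W. measure M (C b)) = measure M (\<Union>b\<in>W. C b)"
    using C disj fin by (intro finite_measure_finite_Union[symmetric]) auto
  then have one: "(\<Sum>b\<in>W. measure M (C b)) = 1"
    by (simp add: cover prob_space)
  have "P.prob {x \<in> space ?P. x \<notin> D \<and> (\<forall>j\<in>J. m \<le> card {i \<in> I. x i \<in> C j})} \<le> P.prob (\<Union>f\<in>\<Lambda>. E f)"
    using sub Em fin\<Lambda> by (intro P.finite_measure_mono) auto
  also have "\<dots> \<le> (\<Sum>f\<in>\<Lambda>. P.prob (E f))"
    using Em fin\<Lambda> by (intro P.finite_measure_subadditive_finite) auto
  also have "\<dots> \<le> (\<Sum>f\<in>\<Lambda>. (1 - p) ^ card J * (\<Prod>i\<in>I. measure M (C (f i))))"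
    by (intro sum_mono bound)
  \<comment> \<open>Extending the sum to all assignments makes it factor over the points. Each
    factor is the total mass of the cells, which is 1.\<close>
  also have "\<dots> \<le> (\<Sum>f\<in>I \<rightarrow>\<^sub>E W. (1 - p) ^ card J * (\<Prod>i\<in>I. measure M (C (f i))))"
    using fin\<Lambda> \<open>p \<le> 1\<close> by (intro sum_mono2) (auto simp: \<Lambda>_def intro!: mult_nonneg_nonneg prod_nonneg)
  also have "\<dots> = (1 - p) ^ card J * (\<Prod>i\<in>I. \<Sum>b\<in>W. measure M (C b))"
    using fin by (subst prod_sum_PiE) (simp_all add: sum_distrib_left)
  finally show ?thesis
    by (simp add: one)
qed

text \<open>Split the first \<open>m * l\<close> indices into \<open>m\<close> groups of length
  \<open>l\<close>. If every group had a point in \<open>B\<close>, there would be \<open>m\<close>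
  points in \<open>B\<close>, so with fewer than \<open>m\<close> of them some group misses
  \<open>B\<close> entirely.\<close>

lemma prob_few_points_le:
  assumes B: "B \<in> sets M" and "m * l \<le> n"
  shows "measure (PiM {..<n} (\<lambda>_. M)) {x \<in> space (PiM {..<n} (\<lambda>_. M)). card {i \<in> {..<n}. x i \<in> B} < m}
    \<le> m * (1 - measure M B) ^ l"
proof -
  interpret P: product_prob_space "\<lambda>_. M" "{..<n}"
    by unfold_locales
  let ?P = "PiM {..<n} (\<lambda>_. M)"
  let ?R = "\<lambda>r. {r * l..<(r + 1) * l}"
  let ?E = "\<lambda>r. {x \<in> space ?P. \<forall>i\<in>?R r. x i \<in> space M - B}"
  have Rn: "?R r \<subseteq> {..<n}" if "r < m" for r
  proof
    fix i assume "i \<in> ?R r"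
    then have "i < (r + 1) * l"
      by simp
    also have "\<dots> \<le> m * l"
      using that by (intro mult_right_mono) auto
    finally show "i \<in> {..<n}"
      using \<open>m * l \<le> n\<close> by simp
  qed
  have Em: "?E r \<in> sets ?P" if "r < m" for r
    using Rn[OF that] B by (intro sets_PiM_Collect_const) auto
  have sub: "{x \<in> space ?P. card {i \<in> {..<n}. x i \<in> B} < m} \<subseteq> (\<Union>r<m. ?E r)"
  proof (rule ccontr)
    assume "\<not> ?thesis"
    then obtain x where x: "x \<in> space ?P" "card {i \<in> {..<n}. x i \<in> B} < m" "\<And>r. r < m \<Longrightarrow> x \<notin> ?E r"
      by blast
    have "\<exists>i. r < m \<longrightarrow> i \<in> ?R r \<and> x i \<in> B" for r
    proof (cases "r < m")
      case True
      then obtain i where "i \<in> ?R r" "x i \<notin> space M - B"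
        using x(1) x(3)[OF True] by blast
      moreover from this have "x i \<in> space M"
        using x(1) Rn[OF True] by (auto simp: space_PiM PiE_iff)
      ultimately show ?thesis
        by auto
    qed simp
    then obtain h where h: "\<And>r. r < m \<Longrightarrow> h r \<in> ?R r \<and> x (h r) \<in> B"
      by metis
    \<comment> \<open>The group number can be recovered from an index, so hits chosen from different
      groups are different points.\<close>
    have "h r div l = r" if "r < m" for r
      using h[OF that] by (intro div_nat_eqI) (simp_all add: mult.commute)
    then have "inj_on h {..<m}"
      by (metis inj_onI lessThan_iff)
    moreover have "h ` {..<m} \<subseteq> {i \<in> {..<n}. x i \<in> B}"
      using h Rn by blast
    ultimately have "card {..<m} \<le> card {i \<in> {..<n}. x i \<in> B}"
      by (intro card_inj_on_le[of h]) auto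
    with x(2) show False
      by simp
  qed
  have "P.prob {x \<in> space ?P. card {i \<in> {..<n}. x i \<in> B} < m} \<le> P.prob (\<Union>r<m. ?E r)"
    using sub Em by (intro P.finite_measure_mono) auto
  also have "\<dots> \<le> (\<Sum>r<m. P.prob (?E r))"
    using Em by (intro P.finite_measure_subadditive_finite) auto
  also have "\<dots> = (\<Sum>r<m. (1 - measure M B) ^ l)"
  proof (rule sum.cong[OF refl])
    fix r assume "r \<in> {..<m}"
    then have "P.prob (?E r) = (\<Prod>i\<in>?R r. measure M (space M - B))"
      using B Rn[of r] by (intro measure_PiM_Collect_const) auto
    then show "P.prob (?E r) = (1 - measure M B) ^ l"
      by (simp add: prob_compl[OF B])
  qed
  finally show ?thesis
    by simp
qed

text \<open>Union bound over the sets \<open>B z\<close> and over the \<open>m\<close>-element sets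
  of indices that could all land in \<open>B z\<close>, whose number is at most
  \<open>card I ^ m\<close>.\<close>

lemma prob_cluster_le:
  fixes \<theta> :: real
  assumes "finite I" "finite Z" and B: "\<And>z. z \<in> Z \<Longrightarrow> B z \<in> sets M" "\<And>z. z \<in> Z \<Longrightarrow> measure M (B z) \<le> \<theta>"
    and "\<theta> \<ge> 0"
  shows "measure (PiM I (\<lambda>_. M)) {x \<in> space (PiM I (\<lambda>_. M)). \<exists>z\<in>Z. m \<le> card {i \<in> I. x i \<in> B z}}
    \<le> card Z * (card I * \<theta>) ^ m"
proof -
  interpret P: product_prob_space "\<lambda>_. M" I
    by unfold_locales
  let ?P = "PiM I (\<lambda>_. M)"
  let ?S = "{V. V \<subseteq> I \<and> card V = m}"
  let ?E = "\<lambda>(z, V). {x \<in> space ?P. \<forall>i\<in>V. x i \<in> B z}"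
  have finS: "finite ?S"
    using \<open>finite I\<close> by simp
  have Em: "?E p \<in> sets ?P" if p: "p \<in> Z \<times> ?S" for p
  proof -
    obtain z V where zV: "p = (z, V)" "z \<in> Z" "V \<subseteq> I" "card V = m"
      using p by auto
    show ?thesis
      using zV B(1) finite_subset[OF zV(3) \<open>finite I\<close>] by (auto intro!: sets_PiM_Collect_const)
  qed
  have sub: "{x \<in> space ?P. \<exists>z\<in>Z. m \<le> card {i \<in> I. x i \<in> B z}} \<subseteq> (\<Union>p\<in>Z \<times> ?S. ?E p)"
  proof safe
    fix x z assume x: "x \<in> space ?P" "z \<in> Z" "m \<le> card {i \<in> I. x i \<in> B z}"
    obtain V where "V \<subseteq> {i \<in> I. x i \<in> B z}" "card V = m"
      using obtain_subset_with_card_n[OF x(3)] by metis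
    then show "x \<in> (\<Union>p\<in>Z \<times> ?S. ?E p)"
      using x by (intro UN_I[of "(z, V)"]) auto
  qed
  have bound: "P.prob (?E p) \<le> \<theta> ^ m" if p: "p \<in> Z \<times> ?S" for p
  proof -
    obtain z V where zV: "p = (z, V)" "z \<in> Z" "V \<subseteq> I" "card V = m"
      using p by auto
    have "P.prob (?E p) = measure M (B z) ^ m"
      using zV B(1) finite_subset[OF zV(3) \<open>finite I\<close>] by (simp add: measure_PiM_Collect_const)
    also have "\<dots> \<le> \<theta> ^ m"
      using B(2) zV by (intro power_mono) auto
    finally show ?thesis .
  qed
  have "P.prob {x \<in> space ?P. \<exists>z\<in>Z. m \<le> card {i \<in> I. x i \<in> B z}} \<le> P.prob (\<Union>p\<in>Z \<times> ?S. ?E p)"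
    using sub Em finS \<open>finite Z\<close> by (intro P.finite_measure_mono) (auto intro!: sets.finite_UN)
  also have "\<dots> \<le> (\<Sum>p\<in>Z \<times> ?S. P.prob (?E p))"
    using Em finS \<open>finite Z\<close> by (intro P.finite_measure_subadditive_finite) auto
  also have "\<dots> \<le> (\<Sum>p\<in>Z \<times> ?S. \<theta> ^ m)"
    by (intro sum_mono bound)
  also have "\<dots> = card Z * (card I choose m) * \<theta> ^ m"
    using \<open>finite I\<close> by (simp add: card_cartesian_product n_subsets)
  also have "\<dots> \<le> card Z * (real (card I) ^ m) * \<theta> ^ m"
  proof -
    have "card I choose m \<le> card I ^ m"
      by (cases "m \<le> card I") (simp_all add: binomial_le_pow binomial_eq_0)
    then have "real (card I choose m) \<le> real (card I) ^ m"
      by (metis of_nat_le_iff of_nat_power)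
    with \<open>\<theta> \<ge> 0\<close> show ?thesis
      by (auto intro!: mult_right_mono mult_left_mono)
  qed
  finally show ?thesis
    by (simp add: power_mult_distrib)
qed

end

section \<open>Block patterns\<close>

text \<open>In \<open>a ^ n - b ^ n = (a - b) * (a ^ (n - 1) + ... + b ^ (n - 1))\<close> each of
  the \<open>n\<close> summands is at least \<open>b ^ (n - 1)\<close>.\<close>

lemma power_diff_ge:
  fixes a b :: real
  assumes "0 \<le> b" "b \<le> a"
  shows "n * (a - b) * b ^ (n - 1) \<le> a ^ n - b ^ n"
proof (induction n)
  case (Suc n)
  have "real (Suc n) * (a - b) * b ^ n = b * (n * (a - b) * b ^ (n - 1)) + (a - b) * b ^ n"
    by (cases n) (auto simp: algebra_simps)
  also have "\<dots> \<le> a * (a ^ n - b ^ n) + (a - b) * b ^ n"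
    using assms by (intro add_right_mono order_trans[OF mult_left_mono[OF Suc.IH] mult_right_mono])
      (auto intro: power_mono)
  also have "\<dots> = a ^ Suc n - b ^ Suc n"
    by (simp add: algebra_simps)
  finally show ?case
    by simp
qed simp

text \<open>With \<open>m = N - 1\<close> the base is \<open>1 / (1 + 1 / m)\<close>, and
  \<open>(1 + 1 / m) ^ m\<close> is at most \<open>exp 1\<close>. For \<open>N = 1\<close> the
  exponent is 0.\<close>

lemma exp_minus_one_le_power:
  assumes "N \<ge> 1"
  shows "exp (- 1) \<le> (1 - 1 / real N) ^ (N - 1)"
proof (cases "N = 1")
  case False
  define m where "m = N - 1"
  have m: "m \<ge> 1" "N = Suc m"
    using assms False by (auto simp: m_def)
  have "1 + 1 / real m \<le> exp (1 / real m)"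
    by (rule exp_ge_add_one_self)
  then have "(1 + 1 / real m) ^ m \<le> exp (1 / real m) ^ m"
    by (intro power_mono) auto
  also have "\<dots> = exp 1"
    using m by (simp flip: exp_of_nat_mult)
  finally have "exp (- 1) \<le> 1 / (1 + 1 / real m) ^ m"
    by (simp add: exp_minus divide_simps add_pos_nonneg)
  also have "\<dots> = (1 - 1 / real N) ^ (N - 1)"
  proof -
    have "1 - 1 / real N = 1 / (1 + 1 / real m)"
      using m by (simp add: field_simps)
    then show ?thesis
      using m by (simp add: power_one_over)
  qed
  finally show ?thesis .
qed simp

context prob_space
begin

text \<open>Block \<open>k\<close> has \<open>N = L ^ k\<close> points, and \<open>F k\<close> omits
  the fraction \<open>1 / N\<close> of \<open>B\<close>. Relative to all points lying in
  \<open>B\<close>, the chance that the block stays in \<open>E k\<close> but not in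
  \<open>F k\<close> is at least \<open>N * (\<sigma> / N) * (1 - 1 / N) ^ (N - 1)\<close>, hence at
  least \<open>\<sigma> * exp (- 1)\<close> whatever \<open>k\<close> is. Block \<open>0\<close> is
  a single point and contributes \<open>\<kappa>\<close>.\<close>

lemma prob_block_pattern_ge:
  fixes U :: "nat \<Rightarrow> 'i set" and E F :: "nat \<Rightarrow> 'a set" and L :: nat and \<kappa> \<sigma> :: real
  assumes "finite T" and U: "\<And>k. k \<le> K \<Longrightarrow> U k \<subseteq> T" "disjoint_family_on U {..K}"
    "\<And>k. k \<le> K \<Longrightarrow> card (U k) = L ^ k"
    and ms: "B \<in> sets M" "core \<in> sets M"
      "\<And>k. k \<in> {1..K} \<Longrightarrow> E k \<in> sets M" "\<And>k. k \<in> {1..K} \<Longrightarrow> F k \<in> sets M"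
    and sub: "core \<subseteq> B" "\<And>k. k \<in> {1..K} \<Longrightarrow> F k \<subseteq> E k" "\<And>k. k \<in> {1..K} \<Longrightarrow> E k \<subseteq> B"
    and mcore: "measure M core = \<kappa> * measure M B"
    and mF: "\<And>k. k \<in> {1..K} \<Longrightarrow> measure M (F k) = measure M B * (1 - 1 / L ^ k)"
    and mE: "\<And>k. k \<in> {1..K} \<Longrightarrow> measure M (E k) = measure M (F k) + \<sigma> * measure M B / L ^ k"
    and pos: "0 \<le> \<kappa>" "0 \<le> \<sigma>" "1 \<le> L"
  defines "A \<equiv> {y \<in> \<Pi>\<^sub>E i\<in>T. B. (\<forall>i\<in>U 0. y i \<in> core) \<and>
    (\<forall>k\<in>{1..K}. (\<forall>i\<in>U k. y i \<in> E k) \<and> (\<exists>i\<in>U k. y i \<notin> F k))}"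
  shows "A \<in> sets (PiM T (\<lambda>_. M))"
    and "\<kappa> * (\<sigma> * exp (- 1)) ^ K * measure M B ^ card T \<le> measure (PiM T (\<lambda>_. M)) A"
proof -
  interpret P: product_prob_space "\<lambda>_. M" T
    by unfold_locales
  let ?P = "PiM T (\<lambda>_. M)"
  \<comment> \<open>The points of \<open>T\<close> in no block form one further block with index
    \<open>Suc K\<close>, constrained only to lie in \<open>B\<close>, so that the sets
    \<open>V b\<close> partition \<open>T\<close>.\<close>
  define V where "V b = (if b \<le> K then U b else T - (\<Union>k\<le>K. U k))" for b
  define Q where "Q b = (if b = 0 then \<Pi>\<^sub>E i\<in>U 0. core else if b \<le> K then (\<Pi>\<^sub>E i\<in>U b. E b) - (\<Pi>\<^sub>E i\<in>U b. F b)
    else \<Pi>\<^sub>E i\<in>V b. B)" for b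
  have VT: "V b \<subseteq> T" for b
    using U(1) by (auto simp: V_def)
  have finV: "finite (V b)" for b
    using VT \<open>finite T\<close> finite_subset by blast
  have Vdisj: "disjoint_family_on V {..Suc K}"
    using U(2) unfolding disjoint_family_on_def V_def by auto
  have VUn: "(\<Union>b\<le>Suc K. V b) = T"
  proof
    show "T \<subseteq> (\<Union>b\<le>Suc K. V b)"
    proof
      fix i assume "i \<in> T"
      show "i \<in> (\<Union>b\<le>Suc K. V b)"
      proof (cases "\<exists>k\<le>K. i \<in> U k")
        case True
        then show ?thesis
          by (auto simp: V_def intro: le_SucI)
      next
        case False
        then show ?thesis
          using \<open>i \<in> T\<close> by (intro UN_I[of "Suc K"]) (auto simp: V_def)
      qed
    qed
  qed (use VT in auto)
  have Qs: "Q b \<in> sets (PiM (V b) (\<lambda>_. M))" for b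
    using ms finV[of b] by (auto simp: Q_def V_def intro!: sets.Diff sets_PiM_I_finite)
  have Bsp: "B \<subseteq> space M"
    using ms(1) by (rule sets.sets_into_space)
  have Aeq: "A = {x \<in> space ?P. \<forall>b\<in>{..Suc K}. restrict x (V b) \<in> Q b}"
  proof (intro equalityI subsetI)
    fix y assume y: "y \<in> A"
    then have yB: "\<And>i. i \<in> T \<Longrightarrow> y i \<in> B" "y \<in> extensional T"
      by (auto simp: A_def PiE_iff)
    have "restrict y (V b) \<in> Q b" if b: "b \<le> Suc K" for b
    proof -
      consider "b = 0" | "b \<in> {1..K}" | "b = Suc K"
        using b by force
      then show ?thesis
      proof cases
        case 1
        then show ?thesis
          using y by (auto simp: Q_def V_def A_def)
      next
        case 2
        then show ?thesis
          using y by (auto simp: Q_def V_def A_def PiE_iff)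
      next
        case 3
        then show ?thesis
          using yB VT[of b] by (auto simp: Q_def)
      qed
    qed
    then show "y \<in> {x \<in> space ?P. \<forall>b\<in>{..Suc K}. restrict x (V b) \<in> Q b}"
      using yB Bsp by (auto simp: space_PiM PiE_iff)
  next
    fix y assume y: "y \<in> {x \<in> space ?P. \<forall>b\<in>{..Suc K}. restrict x (V b) \<in> Q b}"
    then have Qb: "restrict y (V b) \<in> Q b" if "b \<le> Suc K" for b
      using that by auto
    have core: "y i \<in> core" if "i \<in> U 0" for i
      using Qb[of 0] that by (auto simp: Q_def V_def PiE_iff)
    have blk: "\<forall>i\<in>U k. y i \<in> E k" "\<exists>i\<in>U k. y i \<notin> F k" if "k \<in> {1..K}" for k
      using Qb[of k] that by (auto simp: Q_def V_def PiE_iff)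
    have "y i \<in> B" if "i \<in> T" for i
    proof -
      obtain b where b: "b \<le> Suc K" "i \<in> V b"
        using \<open>i \<in> T\<close> VUn by auto
      consider "b = 0" | "b \<in> {1..K}" | "b = Suc K"
        using b(1) by force
      then show ?thesis
      proof cases
        case 1
        then show ?thesis
          using core sub(1) b by (auto simp: V_def)
      next
        case 2
        then have "i \<in> U b"
          using b by (auto simp: V_def)
        then show ?thesis
          using blk(1)[OF 2] sub(3)[OF 2] by auto
      next
        case 3
        then show ?thesis
          using Qb[of b] b by (auto simp: Q_def PiE_iff)
      qed
    qed
    then show "y \<in> A"
      using y core blk by (auto simp: A_def space_PiM PiE_iff)
  qed
  have "A = space ?P \<inter> (\<Inter>b\<in>{..Suc K}. (\<lambda>x. restrict x (V b)) -` Q b \<inter> space ?P)"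
    unfolding Aeq by auto
  also have "\<dots> \<in> sets ?P"
    using Qs VT
    by (intro sets.Int sets.top sets.finite_INT measurable_sets[OF measurable_restrict_subset]) auto
  finally show "A \<in> sets ?P" .
  \<comment> \<open>\<open>w b\<close> bounds from below the probability of the requirement on block
    \<open>b\<close>, relative to the probability that the whole block lies in
    \<open>B\<close>.\<close>
  define w where "w b = (if b = 0 then \<kappa> else if b \<le> K then \<sigma> * exp (- 1) else 1)" for b
  have w: "w b * measure M B ^ card (V b) \<le> measure (PiM (V b) (\<lambda>_. M)) (Q b)" if b: "b \<le> Suc K" for b
  proof -
    interpret Pb: product_prob_space "\<lambda>_. M" "V b"
      by unfold_locales
    consider "b = 0" | "b \<in> {1..K}" | "b = Suc K"
      using b by force
    then show ?thesis
    proof cases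
      case 1
      have "card (V b) = 1"
        using U(3)[of 0] 1 by (simp add: V_def)
      moreover have "Pb.prob (\<Pi>\<^sub>E i\<in>V b. core) = measure M core ^ card (V b)"
        using finV ms by (subst measure_PiM_PiE_const) auto
      ultimately show ?thesis
        using 1 mcore by (simp add: w_def Q_def V_def)
    next
      case 2
      define N where "N = L ^ b"
      have N: "N \<ge> 1" "card (V b) = N"
        using pos 2 U(3)[of b] by (auto simp: N_def V_def)
      have le: "measure M (F b) \<le> measure M (E b)"
        using ms 2 sub by (intro finite_measure_mono) auto
      have Npos: "0 < real N" "real L ^ b = real N"
        using N pos by (auto simp: N_def)
      have "w b * measure M B ^ card (V b) = \<sigma> * measure M B ^ N * exp (- 1)"
        using 2 N by (simp add: w_def)
      also have "\<dots> \<le> \<sigma> * measure M B ^ N * (1 - 1 / N) ^ (N - 1)"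
        using N pos by (intro mult_left_mono exp_minus_one_le_power) auto
      also have "\<dots> = N * (measure M (E b) - measure M (F b)) * measure M (F b) ^ (N - 1)"
      proof -
        have "measure M B ^ N = measure M B * measure M B ^ (N - 1)"
          using N by (cases N) auto
        then show ?thesis
          unfolding mE[OF 2] mF[OF 2] using Npos(1) by (simp add: power_mult_distrib Npos(2))
      qed
      also have "\<dots> \<le> measure M (E b) ^ N - measure M (F b) ^ N"
        using le by (intro power_diff_ge) auto
      also have "measure M (E b) ^ N = Pb.prob (\<Pi>\<^sub>E i\<in>V b. E b)"
        using finV N 2 ms by (subst measure_PiM_PiE_const) auto
      also have "measure M (F b) ^ N = Pb.prob (\<Pi>\<^sub>E i\<in>V b. F b)"
        using finV N 2 ms by (subst measure_PiM_PiE_const) auto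
      also have "Pb.prob (\<Pi>\<^sub>E i\<in>V b. E b) - Pb.prob (\<Pi>\<^sub>E i\<in>V b. F b)
          = Pb.prob ((\<Pi>\<^sub>E i\<in>V b. E b) - (\<Pi>\<^sub>E i\<in>V b. F b))"
        using finV 2 ms sub
        by (intro Pb.finite_measure_Diff[symmetric] sets_PiM_I_finite PiE_mono) auto
      also have "\<dots> = Pb.prob (Q b)"
        using 2 by (simp add: Q_def V_def)
      finally show ?thesis .
    next
      case 3
      have "Pb.prob (\<Pi>\<^sub>E i\<in>V b. B) = measure M B ^ card (V b)"
        using finV ms by (subst measure_PiM_PiE_const) auto
      with 3 show ?thesis
        by (simp add: Q_def w_def)
    qed
  qed
  have "(\<Prod>b\<le>Suc K. w b) = \<kappa> * (\<sigma> * exp (- 1)) ^ K"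
  proof -
    have "(\<Prod>b\<le>Suc K. w b) = w 0 * (\<Prod>b<K. w (Suc b)) * w (Suc K)"
      by (subst prod.atMost_Suc, subst prod.atMost_shift) simp
    also have "(\<Prod>b<K. w (Suc b)) = (\<sigma> * exp (- 1)) ^ K"
      by (simp add: w_def)
    finally show ?thesis
      by (simp add: w_def)
  qed
  moreover have "(\<Prod>b\<le>Suc K. measure M B ^ card (V b)) = measure M B ^ card T"
  proof -
    have "card T = (\<Sum>b\<le>Suc K. card (V b))"
      using Vdisj finV by (subst VUn[symmetric], intro card_UN_disjoint) (auto simp: disjoint_family_on_def)
    then show ?thesis
      by (simp only: power_sum)
  qed
  ultimately have "\<kappa> * (\<sigma> * exp (- 1)) ^ K * measure M B ^ card T
      = (\<Prod>b\<le>Suc K. w b * measure M B ^ card (V b))"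
    by (simp add: prod.distrib)
  also have "\<dots> \<le> (\<Prod>b\<le>Suc K. measure (PiM (V b) (\<lambda>_. M)) (Q b))"
    using w pos by (intro prod_mono) (auto simp: w_def)
  also have "\<dots> = P.prob A"
    unfolding Aeq using VT Vdisj Qs \<open>finite T\<close> by (intro measure_PiM_blocks[symmetric]) auto
  finally show "\<kappa> * (\<sigma> * exp (- 1)) ^ K * measure M B ^ card T \<le> P.prob A" .
qed

end

section \<open>Consecutive blocks of arrivals\<close>

lemma ex_smallest_elements:
  fixes S :: "'a :: linorder set"
  assumes "finite S" "m \<le> card S"
  obtains V where "V \<subseteq> S" "card V = m" "\<And>i j. i \<in> V \<Longrightarrow> j \<in> S - V \<Longrightarrow> i < j"
proof -
  have "m \<le> card S \<Longrightarrow> \<exists>V. V \<subseteq> S \<and> card V = m \<and> (\<forall>i\<in>V. \<forall>j\<in>S - V. i < j)"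
  proof (induction m)
    case 0
    then show ?case
      by (intro exI[of _ "{}"]) auto
  next
    case (Suc m)
    then obtain V where V: "V \<subseteq> S" "card V = m" "\<forall>i\<in>V. \<forall>j\<in>S - V. i < j"
      by auto
    then have ne: "S - V \<noteq> {}" "finite (S - V)"
      using Suc.prems assms(1) by auto
    let ?i = "Min (S - V)"
    have i: "?i \<in> S - V" "\<And>j. j \<in> S - V \<Longrightarrow> ?i \<le> j"
      using Min_in[OF ne(2,1)] Min_le[OF ne(2)] by auto
    have "finite V"
      using V(1) assms(1) finite_subset by blast
    then show ?case
      using V i by (intro exI[of _ "insert ?i V"]) (force simp: le_less)
  qed
  with assms(2) show ?thesis
    using that by blast
qed

text \<open>Repeatedly take the smallest elements of what is left. The order matters for the tree:
  when a vertex of a block arrives, the points of \<open>T\<close> already present belong to the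
  same or to earlier blocks.\<close>

lemma ex_consecutive_blocks:
  fixes T :: "'a :: linorder set" and f :: "nat \<Rightarrow> nat"
  assumes "finite T" "(\<Sum>k<K. f k) \<le> card T"
  obtains U where "\<And>k. k < K \<Longrightarrow> U k \<subseteq> T" "\<And>k. k < K \<Longrightarrow> card (U k) = f k"
    "\<And>k k' i i'. k < k' \<Longrightarrow> k' < K \<Longrightarrow> i \<in> U k \<Longrightarrow> i' \<in> U k' \<Longrightarrow> i < i'"
    "\<And>k i j. k < K \<Longrightarrow> i \<in> U k \<Longrightarrow> j \<in> T - (\<Union>k<K. U k) \<Longrightarrow> i < j"
proof -
  \<comment> \<open>The last clause, by which leftover elements exceed all chosen ones, lets the
    induction append a block drawn from the leftovers.\<close>
  let ?Q = "\<lambda>K U. (\<forall>k<K. U k \<subseteq> T \<and> card (U k) = f k) \<and>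
      (\<forall>k k'. k < k' \<longrightarrow> k' < K \<longrightarrow> (\<forall>i\<in>U k. \<forall>i'\<in>U k'. i < i')) \<and>
      (\<forall>k<K. \<forall>i\<in>U k. \<forall>j\<in>T - (\<Union>k<K. U k). i < j)"
  have "(\<Sum>k<K. f k) \<le> card T \<Longrightarrow> \<exists>U. ?Q K U"
  proof (induction K)
    case (Suc K)
    have "(\<Sum>k<K. f k) \<le> card T"
      using Suc.prems by simp
    from Suc.IH[OF this] obtain U where Q: "?Q K U" ..
    note Q1 = conjunct1[OF Q] and Q2 = conjunct1[OF conjunct2[OF Q]] and Q3 = conjunct2[OF conjunct2[OF Q]]
    have U: "U k \<subseteq> T" "card (U k) = f k" if "k < K" for k
      using Q1 that by blast+
    have Uord: "i < i'" if "k < k'" "k' < K" "i \<in> U k" "i' \<in> U k'" for k k' i i'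
      using Q2 that by blast
    have Urest: "i < j" if "k < K" "i \<in> U k" "j \<in> T - (\<Union>k<K. U k)" for k i j
      using Q3 that by blast
    let ?R = "T - (\<Union>k<K. U k)"
    have finU: "finite (U k)" if "k < K" for k
      using U(1)[OF that] assms(1) finite_subset by blast
    have "card (\<Union>k<K. U k) \<le> (\<Sum>k<K. card (U k))"
      by (rule card_UN_le) simp
    also have "\<dots> = (\<Sum>k<K. f k)"
      by (simp add: U(2))
    finally have "f K \<le> card ?R"
      using Suc.prems finU by (subst card_Diff_subset) (use U(1) in auto)
    then obtain V where V: "V \<subseteq> ?R" "card V = f K" "\<And>i j. i \<in> V \<Longrightarrow> j \<in> ?R - V \<Longrightarrow> i < j"
      using ex_smallest_elements[of ?R "f K"] assms(1) by blast
    define U' where "U' = U(K := V)"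
    have U'lt: "U' k = U k" if "k < K" for k
      using that by (simp add: U'_def)
    have UN: "(\<Union>k<Suc K. U' k) = (\<Union>k<K. U k) \<union> V"
      unfolding lessThan_Suc by (auto simp: U'_def split: if_splits)
    have 1: "\<forall>k<Suc K. U' k \<subseteq> T \<and> card (U' k) = f k"
      using U(1,2) V(1,2) by (auto simp: U'_def less_Suc_eq)
    have 2: "i < i'" if "k < k'" "k' < Suc K" "i \<in> U' k" "i' \<in> U' k'" for k k' i i'
    proof (cases "k' = K")
      case True
      then show ?thesis
        using that V(1) Urest[of k i i'] by (auto simp: U'_def)
    next
      case False
      then show ?thesis
        using that Uord[of k k' i i'] by (auto simp: U'_def)
    qed
    have 3: "i < j" if "k < Suc K" "i \<in> U' k" "j \<in> T - (\<Union>k<Suc K. U' k)" for k i j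
    proof (cases "k = K")
      case True
      then show ?thesis
        using that V(3)[of i j] unfolding UN by (auto simp: U'_def)
    next
      case False
      then show ?thesis
        using that Urest[of k i j] unfolding UN by (auto simp: U'_def)
    qed
    have "?Q (Suc K) U'"
    proof (intro conjI allI impI ballI)
      show "U' k \<subseteq> T" "card (U' k) = f k" if "k < Suc K" for k
        using 1 that by blast+
      show "i < i'" if "k < k'" "k' < Suc K" "i \<in> U' k" "i' \<in> U' k'" for k k' i i'
        using that by (rule 2)
      show "i < j" if "k < Suc K" "i \<in> U' k" "j \<in> T - (\<Union>k<Suc K. U' k)" for k i j
        using that by (rule 3)
    qed
    then show ?case
      by (rule exI[where x = U'])
  qed simp
  from this[OF assms(2)] obtain U where Q: "?Q K U" ..
  note Q1 = conjunct1[OF Q] and Q2 = conjunct1[OF conjunct2[OF Q]] and Q3 = conjunct2[OF conjunct2[OF Q]]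
  show ?thesis
  proof (rule that[of U])
    show "U k \<subseteq> T" "card (U k) = f k" if "k < K" for k
      using Q1 that by blast+
    show "i < i'" if "k < k'" "k' < K" "i \<in> U k" "i' \<in> U k'" for k k' i i'
      using Q2 that by blast
    show "i < j" if "k < K" "i \<in> U k" "j \<in> T - (\<Union>k<K. U k)" for k i j
      using Q3 that by blast
  qed
qed

section \<open>Degrees enforced by block patterns, and measurability\<close>

definition outer_region :: "'a::metric_space \<Rightarrow> real \<Rightarrow> nat \<Rightarrow> 'a set" where
  "outer_region c R k = ball c R - ball c (R / 8 ^ k)"

text \<open>With \<open>r = R / 8 ^ k\<close>, a point of the shell is within
  \<open>r / 4 + r / 8\<close> of any point of the ball of radius \<open>r / 8\<close>, but more
  than \<open>3 * r / 4\<close> from every point outside the ball of radius \<open>r\<close>. The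
  inner radius keeps the shell disjoint from all deeper balls.\<close>

definition shell :: "'a::metric_space \<Rightarrow> real \<Rightarrow> nat \<Rightarrow> 'a set" where
  "shell c R k = ball c (R / 8 ^ k / 4) - ball c (R / 8 ^ Suc k)"

lemma ball_div_8_mono:
  assumes "0 < R" "k \<le> k'"
  shows "ball c (R / 8 ^ k') \<subseteq> ball c (R / 8 ^ k)"
  using assms by (intro subset_ball divide_left_mono power_increasing) auto

text \<open>The vertex of block \<open>0\<close> gains a child in each later block, namely the first vertex of the block
  that falls into the shell: all earlier vertices other than the one of block \<open>0\<close> lie outside the ball
  around the shell. Translates by lattice vectors do not interfere, since the ball lies in
  the fundamental cell.\<close>

lemma max_degree_ge_of_blocks:
  fixes x :: "nat \<Rightarrow> real ^ 'd" and n :: nat and s R :: real and c :: "real ^ 'd"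
  defines "s \<equiv> torus_side TYPE('d) n"
  defines "T \<equiv> {i \<in> {..<n}. x i \<in> ball c R}"
  assumes "0 < s" "0 < R" "ball c R \<subseteq> torus_cell s"
    and cell: "\<And>i. i < n \<Longrightarrow> x i \<in> torus_cell s"
    and UT: "\<And>k. k \<le> K \<Longrightarrow> U k \<subseteq> T" and U0: "card (U 0) = 1"
    and ord: "\<And>k k' i i'. k < k' \<Longrightarrow> k' \<le> K \<Longrightarrow> i \<in> U k \<Longrightarrow> i' \<in> U k' \<Longrightarrow> i < i'"
    and rest: "\<And>k i j. k \<le> K \<Longrightarrow> i \<in> U k \<Longrightarrow> j \<in> T - (\<Union>k\<le>K. U k) \<Longrightarrow> i < j"
    and core: "\<And>i. i \<in> U 0 \<Longrightarrow> x i \<in> ball c (R / 8 ^ Suc K)"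
    and E: "\<And>k i. k \<in> {1..K} \<Longrightarrow> i \<in> U k \<Longrightarrow> x i \<in> outer_region c R k \<union> shell c R k"
    and F: "\<And>k. k \<in> {1..K} \<Longrightarrow> \<exists>i\<in>U k. x i \<notin> outer_region c R k"
  shows "K \<le> nn_tree_max_degree n x"
proof -
  obtain v where v: "U 0 = {v}"
    using U0 card_1_singletonE by blast
  have "v < n"
    using UT[of 0] v by (auto simp: T_def)
  \<comment> \<open>\<open>w k\<close> is the first vertex of block \<open>k\<close> outside the
    outer region. By \<open>E\<close> it lies in the shell.\<close>
  define w where "w k = (LEAST i. i \<in> U k \<and> x i \<notin> outer_region c R k)" for k
  have w: "w k \<in> U k" "x (w k) \<notin> outer_region c R k" if "k \<in> {1..K}" for k
    using LeastI_ex[of "\<lambda>i. i \<in> U k \<and> x i \<notin> outer_region c R k"] F[OF that] unfolding w_def by blast+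
  have wleast: "x i \<in> outer_region c R k" if "i \<in> U k" "i < w k" for i k
    using not_less_Least[of i "\<lambda>i. i \<in> U k \<and> x i \<notin> outer_region c R k"] that unfolding w_def by blast
  have wn: "w k < n" "v < w k" if "k \<in> {1..K}" for k
    using UT[of k] w(1)[OF that] that ord[of 0 k v "w k"] v by (auto simp: T_def)
  have child: "nn_parent s x (w k) = v" if k: "k \<in> {1..K}" for k
  proof (rule nn_parent_eqI[OF wn(2)[OF k]])
    fix u assume u: "u < w k" "u \<noteq> v"
    define r where "r = R / 8 ^ k"
    have "r > 0"
      using \<open>0 < R\<close> by (simp add: r_def)
    have xw: "x (w k) \<in> ball c (r / 4)"
      using E[OF k w(1)[OF k]] w(2)[OF k] by (auto simp: shell_def r_def)
    have "x v \<in> ball c (R / 8 ^ Suc k)"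
      using core[of v] v ball_div_8_mono[OF \<open>0 < R\<close>, of "Suc k" "Suc K" c] k by auto
    also have "R / 8 ^ Suc k = r / 8"
      by (simp add: r_def)
    finally have "norm (x (w k) - x v) < r / 4 + r / 8"
      using xw dist_triangle2[of "x (w k)" "x v" c] by (simp add: dist_commute flip: dist_norm)
    then have near: "torus_dist s (x (w k)) (x v) < r / 4 + r / 8"
      using torus_dist_le[of 0 s "x (w k)" "x v"] by simp
    obtain l where l: "l \<in> torus_lattice s" "torus_dist s (x (w k)) (x u) = norm (x (w k) - x u - l)"
      using torus_dist_attained[OF \<open>0 < s\<close>] .
    \<comment> \<open>Otherwise \<open>l = 0\<close>, and \<open>u\<close> is in one of the blocks,
      since the leftover vertices of \<open>T\<close> come later. A later block is excluded by the
      order, block \<open>k\<close> by the minimality of \<open>w k\<close>, and an earlier block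
      \<open>k'\<close> because its vertices avoid the ball of radius \<open>R / 8 ^ Suc k'\<close>,
      which contains \<open>ball c r\<close>.\<close>
    have "x u + l \<notin> ball c r"
    proof
      assume ul: "x u + l \<in> ball c r"
      have rR: "ball c r \<subseteq> ball c R"
        using ball_div_8_mono[OF \<open>0 < R\<close>, of 0 k c] by (simp add: r_def)
      have un: "u < n"
        using u wn(1)[OF k] by simp
      have "l = 0"
        using torus_cell_translate[OF cell[OF un] _ l(1)] ul rR assms(5) by blast
      then have xu: "x u \<in> ball c r"
        using ul by simp
      then have "u \<in> T"
        using un rR by (auto simp: T_def)
      moreover have "u \<notin> T - (\<Union>k\<le>K. U k)"
        using rest[of k "w k" u] w(1)[OF k] k u by auto
      ultimately obtain k' where k': "k' \<le> K" "u \<in> U k'"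
        by blast
      have "k' \<noteq> 0"
        using k' v u by (metis singletonD)
      have "\<not> k < k'"
        using ord[of k k' "w k" u] w(1)[OF k] k' u by auto
      then consider "k' = k" | "k' < k"
        by linarith
      then show False
      proof cases
        case 1
        then show False
          using wleast[of u k] k' u xu by (auto simp: outer_region_def r_def)
      next
        case 2
        have "x u \<in> outer_region c R k' \<union> shell c R k'"
          using E[of k' u] k' \<open>k' \<noteq> 0\<close> by auto
        moreover have "x u \<in> ball c (R / 8 ^ Suc k')" "x u \<in> ball c (R / 8 ^ k')"
          using xu ball_div_8_mono[OF \<open>0 < R\<close>, of "Suc k'" k c] ball_div_8_mono[OF \<open>0 < R\<close>, of k' k c] 2
          unfolding r_def by auto
        ultimately show False
          by (auto simp: outer_region_def shell_def)
      qed
    qed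
    then have "r \<le> dist c (x u + l)"
      by simp
    also have "\<dots> \<le> dist c (x (w k)) + dist (x (w k)) (x u + l)"
      by (rule dist_triangle)
    also have "dist (x (w k)) (x u + l) = torus_dist s (x (w k)) (x u)"
      using l(2) by (simp add: dist_norm algebra_simps)
    \<comment> \<open>The distance to \<open>u\<close> exceeds \<open>3 * r / 4\<close>, that to
      \<open>v\<close> is below \<open>3 * r / 8\<close>.\<close>
    finally have "r - r / 4 < torus_dist s (x (w k)) (x u)"
      using xw by simp
    with near \<open>r > 0\<close> show "torus_dist s (x (w k)) (x v) < torus_dist s (x (w k)) (x u)"
      by simp
  qed
  have "inj_on w {1..K}"
  proof (rule linorder_inj_onI)
    fix k k' assume "k < k'" "k \<in> {1..K}" "k' \<in> {1..K}"
    then show "w k \<noteq> w k'"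
      using ord[of k k' "w k" "w k'"] w(1) by auto
  qed auto
  then have "K = card (w ` {1..K})"
    by (simp add: card_image)
  also have "\<dots> \<le> vertex_degree (nn_tree_edges n x) v"
  proof (intro card_children_le_vertex_degree subsetI)
    fix i assume "i \<in> w ` {1..K}"
    then show "i \<in> nn_children n x v"
      using child wn unfolding nn_children_def s_def by fastforce
  qed
  also have "\<dots> \<le> nn_tree_max_degree n x"
    by (rule max_degree_ge[OF \<open>v < n\<close>])
  finally show ?thesis .
qed

section \<open>Measurability of the maximum degree\<close>

lemma measurable_torus_dist [measurable]:
  fixes f g :: "'b \<Rightarrow> real ^ 'd"
  assumes [measurable]: "f \<in> borel_measurable M" "g \<in> borel_measurable M"
  shows "(\<lambda>x. torus_dist s (f x) (g x)) \<in> borel_measurable M"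
proof -
  have "continuous_on UNIV (\<lambda>z. infdist z (torus_lattice s :: (real ^ 'd) set))"
    by (intro continuous_intros)
  then have [measurable]: "(\<lambda>z. infdist z (torus_lattice s :: (real ^ 'd) set)) \<in> borel_measurable borel"
    by (rule borel_measurable_continuous_onI)
  show ?thesis
    unfolding torus_dist_eq_infdist by measurable
qed

text \<open>Finitely many comparisons of distances replace the \<open>LEAST\<close> operator, a form
  from which measurability can be read off. The strict comparisons with \<open>u < j\<close> encode
  the tie-breaking rule.\<close>

lemma nn_parent_eq_iff:
  assumes "1 \<le> i"
  shows "nn_parent s x i = j \<longleftrightarrow> j < i \<and> (\<forall>u\<in>{..<i}. torus_dist s (x i) (x j) \<le> torus_dist s (x i) (x u)) \<and>
    (\<forall>u\<in>{..<j}. torus_dist s (x i) (x j) < torus_dist s (x i) (x u))"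
    (is "_ \<longleftrightarrow> ?R")
proof
  assume j: "nn_parent s x i = j"
  have *: "torus_dist s (x i) (x j) < torus_dist s (x i) (x u)" if "u < j" for u
  proof -
    have "\<not> is_arg_min (\<lambda>j. torus_dist s (x i) (x j)) (\<lambda>j. j < i) u"
      using that j not_less_Least unfolding nn_parent_def by blast
    moreover have "u < i"
      using that j nn_parent_minimal(1)[OF assms, of s x] by simp
    ultimately obtain u' where "u' < i" "torus_dist s (x i) (x u') < torus_dist s (x i) (x u)"
      by (auto simp: is_arg_min_def)
    then show ?thesis
      using nn_parent_minimal(2)[OF assms \<open>u' < i\<close>, of s x] j by auto
  qed
  show ?R
    using * nn_parent_minimal(1)[OF assms, of s x] nn_parent_minimal(2)[OF assms, of _ s x] j by auto
next
  assume R: ?R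
  show "nn_parent s x i = j"
    unfolding nn_parent_def
  proof (rule Least_equality)
    show "is_arg_min (\<lambda>j. torus_dist s (x i) (x j)) (\<lambda>j. j < i) j"
      using R by (auto simp: is_arg_min_def not_less)
    fix u assume u: "is_arg_min (\<lambda>j. torus_dist s (x i) (x j)) (\<lambda>j. j < i) u"
    show "j \<le> u"
    proof (rule ccontr)
      assume "\<not> j \<le> u"
      then have "torus_dist s (x i) (x j) < torus_dist s (x i) (x u)"
        using R by auto
      then show False
        using u R by (auto simp: is_arg_min_def)
    qed
  qed
qed

text \<open>The maximum degree depends on the positions only through the finitely many parents.\<close>

lemma sets_Collect_max_degree:
  fixes M :: "(real ^ 'd) measure"
  assumes "sets M = sets borel"
  shows "{x \<in> space (PiM {..<n} (\<lambda>_. M)). P (nn_tree_max_degree n x)} \<in> sets (PiM {..<n} (\<lambda>_. M))"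
proof -
  let ?M = "PiM {..<n} (\<lambda>_. M)" and ?s = "torus_side TYPE('d) n"
  let ?D = "\<lambda>p. max_degree {..<n} {{i, p i} | i. 1 \<le> i \<and> i < n}"
  let ?G = "{p \<in> {1..<n} \<rightarrow>\<^sub>E {..<n}. P (?D p)}"
  have comp: "(\<lambda>x. x i) \<in> borel_measurable ?M" if "i < n" for i
    using that assms measurable_component_singleton[of i "{..<n}" "\<lambda>_. M"] by (simp cong: measurable_cong_sets)
  have par: "{x \<in> space ?M. nn_parent ?s x i = j} \<in> sets ?M" if "i \<in> {1..<n}" for i j
  proof (cases "j < i")
    case True
    have [measurable]: "(\<lambda>x. torus_dist ?s (x i) (x u)) \<in> borel_measurable ?M" if "u < n" for u
      using comp[OF that] comp[of i] \<open>i \<in> {1..<n}\<close> by (intro measurable_torus_dist) auto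
    have "j < n" "\<And>u. u < i \<Longrightarrow> u < n" "\<And>u. u < j \<Longrightarrow> u < n"
      using True that by auto
    then show ?thesis
      using True that by (subst nn_parent_eq_iff) (auto intro!: sets.sets_Collect_conj sets.sets_Collect_const sets.sets_Collect_finite_All borel_measurable_le borel_measurable_less)
  next
    case False
    then have "{x \<in> space ?M. nn_parent ?s x i = j} = {}"
      using that nn_parent_minimal(1)[of i ?s] by auto
    then show ?thesis
      by (metis sets.empty_sets)
  qed
  have D: "nn_tree_max_degree n x = ?D p" if "\<forall>i\<in>{1..<n}. nn_parent ?s x i = p i"
    for p and x :: "nat \<Rightarrow> real ^ 'd"
  proof -
    have "nn_tree_edges n x = {{i, p i} | i. 1 \<le> i \<and> i < n}"
    proof (intro equalityI subsetI)
      fix e assume "e \<in> nn_tree_edges n x"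
      then obtain i where "e = {i, nn_parent ?s x i}" "1 \<le> i" "i < n"
        by (auto simp: nn_tree_edges_def)
      with that show "e \<in> {{i, p i} | i. 1 \<le> i \<and> i < n}"
        by auto
    next
      fix e assume "e \<in> {{i, p i} | i. 1 \<le> i \<and> i < n}"
      then obtain i where "e = {i, p i}" "1 \<le> i" "i < n"
        by auto
      with that have "e = {i, nn_parent ?s x i}"
        by auto
      with \<open>1 \<le> i\<close> \<open>i < n\<close> show "e \<in> nn_tree_edges n x"
        by (auto simp: nn_tree_edges_def)
    qed
    then show ?thesis
      by (simp add: nn_tree_max_degree_def)
  qed
  \<comment> \<open>Split according to the whole parent map \<open>p\<close>: finitely many maps are
    possible, and \<open>?G\<close> selects those whose tree satisfies \<open>P\<close>.\<close>
  have "{x \<in> space ?M. P (nn_tree_max_degree n x)}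
      = (\<Union>p\<in>?G. {x \<in> space ?M. \<forall>i\<in>{1..<n}. nn_parent ?s x i = p i})" (is "_ = ?U")
  proof (intro equalityI subsetI)
    fix x assume x: "x \<in> {x \<in> space ?M. P (nn_tree_max_degree n x)}"
    define p where "p = restrict (nn_parent ?s x) {1..<n}"
    have "p \<in> {1..<n} \<rightarrow>\<^sub>E {..<n}"
      using less_trans[OF nn_parent_minimal(1)[of _ ?s x]] unfolding p_def by auto
    moreover have "\<forall>i\<in>{1..<n}. nn_parent ?s x i = p i"
      by (simp add: p_def)
    ultimately show "x \<in> ?U"
      using x D[of x p] by auto
  next
    fix x assume "x \<in> ?U"
    then obtain p where "p \<in> ?G" "x \<in> space ?M" "\<forall>i\<in>{1..<n}. nn_parent ?s x i = p i"
      by blast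
    then show "x \<in> {x \<in> space ?M. P (nn_tree_max_degree n x)}"
      using D[of x p] by simp
  qed
  moreover have "finite ?G"
    by (rule finite_subset[of _ "{1..<n} \<rightarrow>\<^sub>E {..<n}"]) (auto intro: finite_PiE)
  ultimately show ?thesis
    using par by (auto intro!: sets.finite_UN sets.sets_Collect_finite_All)
qed

section \<open>The uniform distribution on the fundamental cell\<close>

lemma sets_torus_cell [measurable]: "(torus_cell s :: (real ^ 'd) set) \<in> sets borel"
proof -
  have "torus_cell s = (\<Inter>i. {x :: real ^ 'd. 0 \<le> x $ i}) \<inter> (\<Inter>i. {x. x $ i < s})"
    by (auto simp: torus_cell_def)
  moreover have "closed (\<Inter>i. {x :: real ^ 'd. 0 \<le> x $ i})"
    by (intro closed_INT ballI closed_Collect_le continuous_intros)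
  moreover have "open (\<Inter>i. {x :: real ^ 'd. x $ i < s})"
    by (intro open_INT ballI open_Collect_less continuous_intros) auto
  ultimately show ?thesis
    by (metis borel_closed borel_open sets.Int)
qed

lemma bounded_torus_cell: "bounded (torus_cell s :: (real ^ 'd) set)"
  by (rule bounded_subset[OF bounded_cbox[of 0 "\<chi> i. s"]])
    (auto simp: torus_cell_def mem_box_cart less_imp_le)

text \<open>The half-open cell lies between an open and a closed box of the same volume.\<close>

lemma measure_torus_cell:
  assumes "0 \<le> s"
  shows "measure lborel (torus_cell s :: (real ^ 'd) set) = s ^ CARD('d)"
proof -
  have sub: "box 0 (\<chi> i. s) \<subseteq> (torus_cell s :: (real ^ 'd) set)"
    "(torus_cell s :: (real ^ 'd) set) \<subseteq> cbox 0 (\<chi> i. s)"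
    by (auto simp: torus_cell_def mem_box_cart less_imp_le)
  have fin: "torus_cell s \<in> fmeasurable (lborel :: (real ^ 'd) measure)"
    using emeasure_bounded_finite[OF bounded_torus_cell] by (auto simp: fmeasurable_def)
  have "measure lborel (box 0 (\<chi> i. s) :: (real ^ 'd) set) \<le> measure lborel (torus_cell s :: (real ^ 'd) set)"
    using sub fin by (intro measure_mono_fmeasurable) auto
  moreover have "measure lborel (torus_cell s :: (real ^ 'd) set) \<le> measure lborel (cbox 0 (\<chi> i. s) :: (real ^ 'd) set)"
    using sub by (intro measure_mono_fmeasurable) (auto simp: fmeasurable_cbox)
  moreover have "measure lborel (box 0 (\<chi> i. s) :: (real ^ 'd) set) = measure lborel (cbox 0 (\<chi> i. s) :: (real ^ 'd) set)"
    by (simp add: measure_lborel_box_eq measure_lborel_cbox_eq)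
  moreover have "measure lborel (cbox 0 (\<chi> i. s) :: (real ^ 'd) set) = s ^ CARD('d)"
    using assms by (subst content_cbox_cart) (auto simp: interval_ne_empty_cart)
  ultimately show ?thesis
    by linarith
qed

context
  fixes s :: real
  assumes s: "0 < s"
begin

lemma prob_space_uniform_torus_cell:
  "prob_space (uniform_measure lborel (torus_cell s :: (real ^ 'd) set))"
proof (rule prob_space_uniform_measure)
  show "emeasure lborel (torus_cell s :: (real ^ 'd) set) \<noteq> \<infinity>"
    using emeasure_bounded_finite[OF bounded_torus_cell[of s]] by (simp add: less_top)
  show "emeasure lborel (torus_cell s :: (real ^ 'd) set) \<noteq> 0"
  proof
    assume "emeasure lborel (torus_cell s :: (real ^ 'd) set) = 0"
    then have "measure lborel (torus_cell s :: (real ^ 'd) set) = 0"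
      by (simp add: measure_def)
    with s show False
      by (simp add: measure_torus_cell)
  qed
qed

lemma measure_uniform_torus_cell:
  fixes A :: "(real ^ 'd) set"
  assumes "A \<in> sets borel"
  shows "measure (uniform_measure lborel (torus_cell s)) A = measure lborel (torus_cell s \<inter> A) / s ^ CARD('d)"
proof -
  have "measure lborel (torus_cell s :: (real ^ 'd) set) = s ^ CARD('d)"
    using s by (simp add: measure_torus_cell)
  moreover have "emeasure lborel (torus_cell s :: (real ^ 'd) set) \<noteq> 0"
    using calculation s by (auto simp: measure_def)
  moreover have "emeasure lborel (torus_cell s :: (real ^ 'd) set) \<noteq> \<infinity>"
    using emeasure_bounded_finite[OF bounded_torus_cell[of s]] by (simp add: less_top)
  ultimately show ?thesis
    using assms by (subst measure_uniform_measure) auto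
qed

lemma measure_uniform_torus_cell_ball:
  fixes c :: "real ^ 'd"
  assumes "ball c r \<subseteq> torus_cell s" "0 \<le> r"
  shows "measure (uniform_measure lborel (torus_cell s)) (ball c r)
    = measure lborel (ball (0 :: real ^ 'd) 1) * r ^ CARD('d) / s ^ CARD('d)"
  using assms content_ball_conv_unit_ball[of r c]
  by (simp add: measure_uniform_torus_cell Int_absorb1)

end

section \<open>The lower bound for fixed size\<close>

text \<open>The event is a finite union over the possible sets \<open>V\<close> of indices whose
  points lie in \<open>B\<close>.\<close>

lemma sets_Collect_card_PiM:
  assumes "finite I" "B \<in> sets M"
  shows "{x \<in> space (PiM I (\<lambda>_. M)). P (card {i \<in> I. x i \<in> B})} \<in> sets (PiM I (\<lambda>_. M))"
proof -
  let ?M = "PiM I (\<lambda>_. M)"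
  let ?G = "{V \<in> Pow I. P (card V)}"
  have "{x \<in> space ?M. x i \<in> B \<longleftrightarrow> i \<in> V} \<in> sets ?M" if "i \<in> I" for i V
  proof -
    have "{x \<in> space ?M. x i \<in> B} = (\<lambda>x. x i) -` B \<inter> space ?M"
      by auto
    also have "\<dots> \<in> sets ?M"
      using that assms by (intro measurable_sets[OF measurable_component_singleton])
    finally have "{x \<in> space ?M. x i \<in> B} \<in> sets ?M" .
    then show ?thesis
      by (cases "i \<in> V") (auto intro: sets.sets_Collect)
  qed
  then have "(\<Union>V\<in>?G. {x \<in> space ?M. \<forall>i\<in>I. x i \<in> B \<longleftrightarrow> i \<in> V}) \<in> sets ?M"
    using assms(1) by (intro sets.finite_UN sets.sets_Collect_finite_All) auto
  also have "(\<Union>V\<in>?G. {x \<in> space ?M. \<forall>i\<in>I. x i \<in> B \<longleftrightarrow> i \<in> V})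
      = {x \<in> space ?M. P (card {i \<in> I. x i \<in> B})}"
  proof (intro equalityI subsetI)
    fix x assume "x \<in> (\<Union>V\<in>?G. {x \<in> space ?M. \<forall>i\<in>I. x i \<in> B \<longleftrightarrow> i \<in> V})"
    then obtain V where "V \<subseteq> I" "P (card V)" "x \<in> space ?M" "\<forall>i\<in>I. x i \<in> B \<longleftrightarrow> i \<in> V"
      by blast
    moreover from this have "{i \<in> I. x i \<in> B} = V"
      by blast
    ultimately show "x \<in> {x \<in> space ?M. P (card {i \<in> I. x i \<in> B})}"
      by simp
  next
    fix x assume "x \<in> {x \<in> space ?M. P (card {i \<in> I. x i \<in> B})}"
    then show "x \<in> (\<Union>V\<in>?G. {x \<in> space ?M. \<forall>i\<in>I. x i \<in> B \<longleftrightarrow> i \<in> V})"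
      by (intro UN_I[of "{i \<in> I. x i \<in> B}"]) auto
  qed
  finally show ?thesis .
qed

lemma torus_side_pos: "n > 0 \<Longrightarrow> 0 < torus_side TYPE('d::finite) n"
  by (simp add: torus_side_def)

lemma torus_side_power: "n > 0 \<Longrightarrow> torus_side TYPE('d::finite) n ^ CARD('d) = real n"
  by (simp add: torus_side_def flip: powr_realpow) (simp add: powr_powr)

text \<open>The underlying space of the uniform measure is all of \<open>real ^ 'd\<close>, so that
  the points lie in the cell is an event of probability 1 and not part of the type of
  outcomes.\<close>

lemma prob_all_in_torus_cell:
  assumes "n > 0"
  shows "measure (vertex_positions n :: (nat \<Rightarrow> real ^ 'd) measure)
    {x \<in> space (vertex_positions n). \<forall>i\<in>{..<n}. x i \<in> torus_cell (torus_side TYPE('d) n)} = 1"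
proof -
  let ?s = "torus_side TYPE('d) n"
  let ?\<mu> = "uniform_measure lborel (torus_cell ?s :: (real ^ 'd) set)"
  interpret prob_space ?\<mu>
    by (rule prob_space_uniform_torus_cell[OF torus_side_pos[OF assms]])
  have "measure ?\<mu> (torus_cell ?s) = 1"
    using torus_side_pos[OF assms, where 'd = 'd]
    by (subst measure_uniform_torus_cell) (auto simp: measure_torus_cell)
  then show ?thesis
    unfolding vertex_positions_def by (subst measure_PiM_Collect_const) auto
qed

text \<open>There are \<open>g\<close> disjoint balls, each hit by a given vertex with probability
  \<open>\<beta>\<close>. A block pattern uses \<open>m\<close> points and, in a ball with at least
  \<open>m\<close> points, occurs with relative probability at least \<open>p\<close>. The first
  summand covers the failure of all sufficiently filled balls, the second the possibility that some
  ball receives fewer than \<open>m\<close> points.\<close>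

lemma prob_low_degree_le:
  fixes n g K l d m :: nat and \<beta> p :: real
  defines "d \<equiv> CARD('d)"
  defines "\<beta> \<equiv> measure lborel (ball (0 :: real ^ 'd) 1) * (1 / (2 * g)) ^ d"
  defines "m \<equiv> (\<Sum>k<Suc K. (8 ^ d) ^ k)"
  defines "p \<equiv> (1 / 8 ^ Suc K) ^ d * (((1 / 4) ^ d - (1 / 8) ^ d) * exp (- 1)) ^ K"
  assumes "0 < n" "0 < g" "m * l \<le> n"
  shows "measure (vertex_positions n :: (nat \<Rightarrow> real ^ 'd) measure)
      {x \<in> space (vertex_positions n). nn_tree_max_degree n x < K}
    \<le> (1 - p) ^ g + g * (m * (1 - \<beta>) ^ l)"
    and "\<beta> \<le> 1" "p \<le> 1"
proof -
  define s where "s = torus_side TYPE('d) n"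
  have s: "s > 0" "s ^ d = n"
    using torus_side_pos torus_side_power \<open>0 < n\<close> by (auto simp: s_def d_def)
  have "d > 0"
    by (simp add: d_def)
  let ?\<mu> = "uniform_measure lborel (torus_cell s :: (real ^ 'd) set)"
  interpret U: prob_space ?\<mu>
    by (rule prob_space_uniform_torus_cell[OF s(1)])
  let ?P = "PiM {..<n} (\<lambda>_. ?\<mu>)"
  interpret P: product_prob_space "\<lambda>_. ?\<mu>" "{..<n}"
    by unfold_locales
  have Peq: "vertex_positions n = ?P"
    by (simp add: vertex_positions_def s_def)
  define R where "R = s / (2 * g)"
  have "R > 0"
    using s \<open>0 < g\<close> by (simp add: R_def)
  define h where "h = s / g"
  have h: "h > 0" "g * h = s" and Rh: "R = h / 2"
    using s \<open>0 < g\<close> by (auto simp: h_def R_def)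
  \<comment> \<open>The balls are inscribed in the \<open>g\<close> subcubes of side
    \<open>h\<close> along the diagonal of the cell. Any single coordinate separates them.\<close>
  define c :: "nat \<Rightarrow> real ^ 'd" where "c j = (\<chi> i. (real j + 1 / 2) * h)" for j
  define B where "B j = ball (c j) R" for j
  have coord: "real j * h < y $ i \<and> y $ i < (real j + 1) * h" if "y \<in> B j" for y j i
  proof -
    have "\<bar>(c j - y) $ i\<bar> < R"
      using that component_le_norm_cart[of "c j - y" i] by (simp add: B_def dist_norm)
    then have "\<bar>real j * h + h / 2 - y $ i\<bar> < h / 2"
      unfolding Rh by (simp add: c_def distrib_right)
    then show ?thesis
      unfolding distrib_right by linarith
  qed
  have Bcell: "B j \<subseteq> torus_cell s" if "j < g" for j
  proof
    fix y assume y: "y \<in> B j"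
    have "0 \<le> y $ i \<and> y $ i < s" for i
    proof -
      have "(real j + 1) * h \<le> g * h"
        using that h by (intro mult_right_mono) auto
      moreover have "0 \<le> real j * h"
        using h by simp
      ultimately show ?thesis
        using coord[OF y, of i] h(2) by linarith
    qed
    then show "y \<in> torus_cell s"
      by (simp add: torus_cell_def)
  qed
  have Bdisj: "B j \<inter> B j' = {}" if "j < j'" for j j'
  proof (rule ccontr)
    assume "B j \<inter> B j' \<noteq> {}"
    then obtain y where y: "y \<in> B j" "y \<in> B j'"
      by blast
    have "(real j + 1) * h \<le> real j' * h"
      using that h by (intro mult_right_mono) auto
    then show False
      \<comment> \<open>Any coordinate serves here; \<open>undefined\<close> merely names
        one.\<close>
      using coord[OF y(1), of undefined] coord[OF y(2), of undefined] by linarith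
  qed
  have mball: "U.prob (ball (c j) (R * t)) = \<beta> * t ^ d" if "j < g" "0 \<le> t" "t \<le> 1" for j t
  proof -
    have "R * t \<le> R"
      using \<open>R > 0\<close> that by (simp add: mult_left_le)
    then have "ball (c j) (R * t) \<subseteq> torus_cell s"
      using Bcell[OF that(1)] subset_ball[of "R * t" R "c j"] by (auto simp: B_def)
    then have "U.prob (ball (c j) (R * t)) = measure lborel (ball (0 :: real ^ 'd) 1) * (R * t) ^ d / s ^ d"
      using that \<open>R > 0\<close> unfolding d_def by (intro measure_uniform_torus_cell_ball s) auto
    also have "\<dots> = \<beta> * t ^ d"
      using s(1) by (simp add: \<beta>_def R_def power_mult_distrib power_divide)
    finally show ?thesis .
  qed
  have mB: "U.prob (B j) = \<beta>" if "j < g" for j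
    using mball[OF that, of 1] by (simp add: B_def)
  show "\<beta> \<le> 1"
    using mB[OF \<open>0 < g\<close>] U.prob_le_1 by metis
  show "p \<le> 1"
  proof -
    have "(1 / 4 :: real) ^ d \<le> 1" "(1 / 8 :: real) ^ d \<le> (1 / 4) ^ d" "(0::real) \<le> (1 / 8) ^ d"
      by (auto intro: power_le_one power_mono)
    then have "0 \<le> (1 / 4 :: real) ^ d - (1 / 8) ^ d" "(1 / 4 :: real) ^ d - (1 / 8) ^ d \<le> 1"
      by linarith+
    then have "0 \<le> ((1 / 4) ^ d - (1 / 8) ^ d) * exp (- 1 :: real)" "((1 / 4) ^ d - (1 / 8) ^ d) * exp (- 1 :: real) \<le> 1"
      by (auto simp del: diff_ge_0_iff_ge intro: mult_le_one)
    moreover have "(1 / 8 ^ Suc K :: real) \<le> 1"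
      by (simp add: divide_le_eq_1 one_le_power del: power_Suc)
    ultimately show ?thesis
      unfolding p_def by (intro mult_le_one[OF power_le_one zero_le_power power_le_one]) auto
  qed
  \<comment> \<open>The complement of all balls becomes the cell with index \<open>g\<close>, so
    that \<open>C\<close> partitions the whole space.\<close>
  define C where "C b = (if b < g then B b else UNIV - (\<Union>j<g. B j))" for b
  have Bs: "B j \<in> sets ?\<mu>" for j
    by (simp add: B_def)
  have Cs: "C b \<in> sets ?\<mu>" for b
    by (simp add: C_def B_def)
  \<comment> \<open>The degree bound for block patterns assumes that all positions are in the
    fundamental cell. Configurations violating this count as successes here and are removed later as
    a null set.\<close>
  define D where "D = {x \<in> space ?P. (\<forall>i\<in>{..<n}. x i \<in> torus_cell s) \<longrightarrow> K \<le> nn_tree_max_degree n x}"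
  have cellS: "{x \<in> space ?P. \<forall>i\<in>{..<n}. x i \<in> torus_cell s} \<in> sets ?P"
    by (intro U.sets_PiM_Collect_const) auto
  have degS: "{x \<in> space ?P. Q (nn_tree_max_degree n x)} \<in> sets ?P" for Q
    by (rule sets_Collect_max_degree) simp
  have Ds: "D \<in> sets ?P"
    unfolding D_def using cellS degS by (intro sets.sets_Collect)
  have succ: "\<exists>A\<in>sets (PiM T (\<lambda>_. ?\<mu>)). A \<subseteq> (\<Pi>\<^sub>E i\<in>T. C j) \<and>
        p * U.prob (C j) ^ card T \<le> measure (PiM T (\<lambda>_. ?\<mu>)) A \<and>
        (\<forall>x\<in>space ?P. {i \<in> {..<n}. x i \<in> C j} = T \<longrightarrow> restrict x T \<in> A \<longrightarrow> x \<in> D)"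
    if jT: "j \<in> {..<g}" "T \<subseteq> {..<n}" "m \<le> card T" for j T
  proof -
    have j: "j < g" "C j = B j"
      using jT by (auto simp: C_def)
    have finT: "finite T"
      using jT(2) finite_subset by blast
    obtain U where UT: "\<And>k. k < Suc K \<Longrightarrow> U k \<subseteq> T"
      and Ucard: "\<And>k. k < Suc K \<Longrightarrow> card (U k) = (8 ^ d) ^ k"
      and Uord: "\<And>k k' i i'. k < k' \<Longrightarrow> k' < Suc K \<Longrightarrow> i \<in> U k \<Longrightarrow> i' \<in> U k' \<Longrightarrow> i < i'"
      and Urest: "\<And>k i j. k < Suc K \<Longrightarrow> i \<in> U k \<Longrightarrow> j \<in> T - (\<Union>k<Suc K. U k) \<Longrightarrow> i < j"
    proof (rule ex_consecutive_blocks[OF finT jT(3)[unfolded m_def]], goal_cases)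
      case (1 U)
      show ?case
        by (rule 1(1)[of U]) (fact 1)+
    qed
    have lt: "U k \<inter> U k' = {}" if "k < k'" "k' < Suc K" for k k'
    proof (rule Int_emptyI)
      fix i assume "i \<in> U k" "i \<in> U k'"
      from Uord[OF that this] show False
        by simp
    qed
    have Udisj: "disjoint_family_on U {..K}"
      unfolding disjoint_family_on_def
    proof (intro ballI impI)
      fix k k' assume k: "k \<in> {..K}" "k' \<in> {..K}" "k \<noteq> k'"
      then consider "k < k'" | "k' < k"
        by linarith
      then show "U k \<inter> U k' = {}"
        using lt[of k k'] lt[of k' k] k by cases auto
    qed
    let ?core = "ball (c j) (R / 8 ^ Suc K)"
    let ?F = "outer_region (c j) R" and ?E = "\<lambda>k. outer_region (c j) R k \<union> shell (c j) R k"
    let ?A = "{y \<in> \<Pi>\<^sub>E i\<in>T. B j. (\<forall>i\<in>U 0. y i \<in> ?core) \<and>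
      (\<forall>k\<in>{1..K}. (\<forall>i\<in>U k. y i \<in> ?E k) \<and> (\<exists>i\<in>U k. y i \<notin> ?F k))}"
    have sub8: "ball (c j) (R / 8 ^ k) \<subseteq> B j" for k
      using ball_div_8_mono[OF \<open>R > 0\<close>, of 0 k "c j"] by (simp add: B_def)
    have sub4: "ball (c j) (R / 8 ^ k / 4) \<subseteq> ball (c j) (R / 8 ^ k)"
      "ball (c j) (R / 8 ^ Suc k) \<subseteq> ball (c j) (R / 8 ^ k / 4)" for k
      using \<open>R > 0\<close> by (auto intro!: subset_ball simp: field_simps)
    have m8: "U.prob (ball (c j) (R / 8 ^ k)) = \<beta> * (1 / 8 ^ k) ^ d" for k
      using mball[OF j(1), of "1 / 8 ^ k"] by simp
    have m4: "U.prob (ball (c j) (R / 8 ^ k / 4)) = \<beta> * (1 / 8 ^ k / 4) ^ d" for k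
    proof -
      have "(1::real) \<le> 8 ^ k"
        by simp
      then have "(1::real) \<le> 8 ^ k * 4"
        by linarith
      then show ?thesis
        using mball[OF j(1), of "1 / 8 ^ k / 4"] by (simp add: divide_le_eq_1)
    qed
    \<comment> \<open>Shrinking the radius by \<open>8 ^ k\<close> shrinks the volume by
      \<open>(8 ^ d) ^ k\<close>, the size of block \<open>k\<close>. This is why the block growth
      factor is \<open>8 ^ d\<close>.\<close>
    have mF: "U.prob (?F k) = U.prob (B j) * (1 - 1 / real (8 ^ d) ^ k)" for k
    proof -
      have "U.prob (?F k) = U.prob (B j) - U.prob (ball (c j) (R / 8 ^ k))"
        unfolding outer_region_def B_def using sub8[of k]
        by (intro U.finite_measure_Diff) (auto simp: B_def)
      also have "\<dots> = U.prob (B j) * (1 - 1 / real (8 ^ d) ^ k)"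
        by (simp add: m8 mB[OF j(1)] algebra_simps power_one_over flip: power_mult)
      finally show ?thesis .
    qed
    have mS: "U.prob (shell (c j) R k) = ((1 / 4) ^ d - (1 / 8) ^ d) * U.prob (B j) / real (8 ^ d) ^ k" for k
    proof -
      have "U.prob (shell (c j) R k) = \<beta> * (1 / 8 ^ k / 4) ^ d - \<beta> * (1 / 8 ^ Suc k) ^ d"
        unfolding shell_def m8[symmetric] m4[symmetric] using sub4
        by (intro U.finite_measure_Diff) auto
      also have "(1 / 8 ^ Suc k :: real) = 1 / 8 ^ k / 8"
        by simp
      also have "\<beta> * (1 / 8 ^ k / 4) ^ d - \<beta> * (1 / 8 ^ k / 8) ^ d
          = ((1 / 4) ^ d - (1 / 8) ^ d) * \<beta> * (1 / 8 ^ k) ^ d"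
        by (simp add: power_divide algebra_simps)
      also have "(1 / 8 ^ k :: real) ^ d = 1 / real (8 ^ d) ^ k"
        by (simp add: power_one_over algebra_simps flip: power_mult)
      finally show ?thesis
        by (simp add: mB[OF j(1)])
    qed
    have mE: "U.prob (?E k) = U.prob (?F k) + ((1 / 4) ^ d - (1 / 8) ^ d) * U.prob (B j) / real (8 ^ d) ^ k" for k
    proof -
      have "U.prob (?E k) = U.prob (?F k) + U.prob (shell (c j) R k)"
        using sub4(1)[of k] by (intro U.finite_measure_Union) (auto simp: outer_region_def shell_def)
      then show ?thesis
        by (simp add: mS)
    qed
    have \<sigma>: "0 \<le> (1 / 4 :: real) ^ d - (1 / 8) ^ d"
      by (simp add: power_mono)
    have H1: "U k \<subseteq> T" "card (U k) = (8 ^ d) ^ k" if "k \<le> K" for k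
      using UT[of k] Ucard[of k] that by auto
    have ES: "?core \<in> sets ?\<mu>" "?E k \<in> sets ?\<mu>" "?F k \<in> sets ?\<mu>" for k
      by (auto simp: outer_region_def shell_def)
    have EB: "?F k \<subseteq> ?E k" "?E k \<subseteq> B j" for k
      using sub4(1)[of k] sub8[of k] by (auto simp: outer_region_def shell_def B_def)
    have mc: "U.prob ?core = (1 / 8 ^ Suc K) ^ d * U.prob (B j)"
      unfolding m8 mB[OF j(1)] by simp
    have A: "?A \<in> sets (PiM T (\<lambda>_. ?\<mu>))"
      "(1 / 8 ^ Suc K) ^ d * (((1 / 4) ^ d - (1 / 8) ^ d) * exp (- 1)) ^ K * U.prob (B j) ^ card T
        \<le> measure (PiM T (\<lambda>_. ?\<mu>)) ?A"
      by (rule U.prob_block_pattern_ge[where L = "8 ^ d" and E = ?E and F = ?F and core = ?core,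
            OF finT H1(1) Udisj H1(2) Bs ES(1) ES(2) ES(3) sub8 EB(1) EB(2) mc _ _ _ \<sigma>];
          simp add: mF mE)+
    show ?thesis
      unfolding j(2)
    proof (intro bexI[of _ ?A] conjI ballI impI)
      show "?A \<subseteq> (\<Pi>\<^sub>E i\<in>T. B j)"
        by blast
      show "p * U.prob (B j) ^ card T \<le> measure (PiM T (\<lambda>_. ?\<mu>)) ?A"
        using A(2) unfolding p_def .
      show "?A \<in> sets (PiM T (\<lambda>_. ?\<mu>))"
        by (fact A(1))
      fix x assume x: "x \<in> space ?P" "{i \<in> {..<n}. x i \<in> B j} = T" "restrict x T \<in> ?A"
      from x(3) have "(\<forall>i\<in>U 0. restrict x T i \<in> ?core) \<and>
          (\<forall>k\<in>{1..K}. (\<forall>i\<in>U k. restrict x T i \<in> ?E k) \<and> (\<exists>i\<in>U k. restrict x T i \<notin> ?F k))"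
        unfolding mem_Collect_eq by (rule conjunct2)
      then have pat: "\<And>i. i \<in> U 0 \<Longrightarrow> restrict x T i \<in> ?core"
        "\<And>k i. k \<in> {1..K} \<Longrightarrow> i \<in> U k \<Longrightarrow> restrict x T i \<in> ?E k"
        "\<And>k. k \<in> {1..K} \<Longrightarrow> \<exists>i\<in>U k. restrict x T i \<notin> ?F k"
        by (metis (no_types))+
      have xU: "restrict x T i = x i" if "i \<in> U k" "k < Suc K" for i k
        using UT[OF that(2)] that(1) by auto
      have "K \<le> nn_tree_max_degree n x" if cell: "\<forall>i\<in>{..<n}. x i \<in> torus_cell s"
      proof (rule max_degree_ge_of_blocks[where c = "c j" and R = R and U = U])
        show "0 < torus_side TYPE('d) n" "0 < R" "ball (c j) R \<subseteq> torus_cell (torus_side TYPE('d) n)"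
          using s \<open>R > 0\<close> Bcell[OF j(1)] by (auto simp: s_def B_def)
        show "x i \<in> torus_cell (torus_side TYPE('d) n)" if "i < n" for i
          using cell that by (simp add: s_def)
        show "U k \<subseteq> {i \<in> {..<n}. x i \<in> ball (c j) R}" if "k \<le> K" for k
          using UT[of k] that x(2) by (simp add: B_def)
        show "card (U 0) = 1"
          using Ucard[of 0] by simp
        show "i < i'" if "k < k'" "k' \<le> K" "i \<in> U k" "i' \<in> U k'" for k k' i i'
          using Uord that by (meson le_imp_less_Suc)
        show "i < j'" if "k \<le> K" "i \<in> U k" "j' \<in> {i \<in> {..<n}. x i \<in> ball (c j) R} - (\<Union>k\<le>K. U k)" for k i j'
        proof (rule Urest)
          show "j' \<in> T - (\<Union>k<Suc K. U k)"
            using that(3) x(2) unfolding B_def lessThan_Suc_atMost by blast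
        qed (use that in auto)
        show "x i \<in> ball (c j) (R / 8 ^ Suc K)" if "i \<in> U 0" for i
          using pat(1)[OF that] xU[of i 0] that by simp
        show "x i \<in> outer_region (c j) R k \<union> shell (c j) R k" if "k \<in> {1..K}" "i \<in> U k" for k i
        proof -
          have "restrict x T i = x i"
            using xU[of i k] that by simp
          then show ?thesis
            using pat(2)[OF that] by (simp only:)
        qed
        show "\<exists>i\<in>U k. x i \<notin> outer_region (c j) R k" if k: "k \<in> {1..K}" for k
        proof -
          obtain i where "i \<in> U k" "restrict x T i \<notin> ?F k"
            using pat(3)[OF k] by blast
          moreover have "restrict x T i = x i"
            using xU[of i k] calculation k by simp
          ultimately show ?thesis
            by (metis (no_types))
        qed
      qed
      then show "x \<in> D"
        using x(1) by (simp add: D_def)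
    qed
  qed
  let ?few = "\<lambda>j. {x \<in> space ?P. card {i \<in> {..<n}. x i \<in> C j} < m}"
  let ?all = "{x \<in> space ?P. x \<notin> D \<and> (\<forall>j\<in>{..<g}. m \<le> card {i \<in> {..<n}. x i \<in> C j})}"
  let ?cell = "{x \<in> space ?P. \<forall>i\<in>{..<n}. x i \<in> torus_cell s}"
  have fewS: "?few j \<in> sets ?P" for j
    by (rule sets_Collect_card_PiM[OF _ Cs]) simp
  have allS: "?all \<in> sets ?P"
  proof -
    have "?all = (space ?P - D) \<inter> (space ?P - (\<Union>j\<in>{..<g}. ?few j))"
      unfolding not_less[symmetric] by blast
    also have "\<dots> \<in> sets ?P"
      by (intro sets.Int sets.Diff sets.finite_UN sets.top Ds fewS) simp
    finally show ?thesis .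
  qed
  have cell1: "P.prob ?cell = 1"
    using prob_all_in_torus_cell[OF \<open>0 < n\<close>, where 'd = 'd] by (simp add: Peq s_def[symmetric])
  have cell0: "P.prob (space ?P - ?cell) = 0"
    unfolding P.P.prob_compl[OF cellS] cell1 by simp
  define X1 where "X1 = ?all"
  define X2 where "X2 = (\<Union>j\<in>{..<g}. ?few j)"
  define X3 where "X3 = space ?P - ?cell"
  have XS: "X1 \<in> sets ?P" "X2 \<in> sets ?P" "X3 \<in> sets ?P"
  proof -
    show "X1 \<in> sets ?P"
      unfolding X1_def by (fact allS)
    show "X2 \<in> sets ?P"
      unfolding X2_def by (intro sets.finite_UN fewS) simp
    show "X3 \<in> sets ?P"
      unfolding X3_def by (intro sets.Diff sets.top cellS)
  qed
  \<comment> \<open>Small maximum degree means that all balls fail although each has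
    \<open>m\<close> points, or that some ball has too few points, or that some position is outside
    the cell.\<close>
  have "x \<in> X1 \<union> X2 \<union> X3" if x: "x \<in> space ?P" "nn_tree_max_degree n x < K" for x
  proof (rule ccontr)
    assume not: "x \<notin> X1 \<union> X2 \<union> X3"
    then have "\<forall>i\<in>{..<n}. x i \<in> torus_cell s"
      using x(1) unfolding X3_def by blast
    then have "x \<notin> D"
      using x(2) unfolding D_def by auto
    moreover have "\<forall>j\<in>{..<g}. m \<le> card {i \<in> {..<n}. x i \<in> C j}"
      using not x(1) unfolding X2_def not_less[symmetric] by blast
    ultimately show False
      using not x(1) unfolding X1_def by blast
  qed
  then have "P.prob {x \<in> space ?P. nn_tree_max_degree n x < K} \<le> P.prob (X1 \<union> X2 \<union> X3)"
    using XS by (intro P.finite_measure_mono) auto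
  also have "\<dots> \<le> P.prob (X1 \<union> X2) + P.prob X3"
    using XS by (intro measure_Un_le) auto
  also have "\<dots> \<le> P.prob X1 + P.prob X2 + P.prob X3"
    using XS by (intro add_right_mono measure_Un_le) auto
  also have "\<dots> = P.prob X1 + P.prob X2"
    using cell0 by (simp add: X3_def)
  finally have split: "P.prob {x \<in> space ?P. nn_tree_max_degree n x < K} \<le> P.prob X1 + P.prob X2" .
  have "P.prob X1 \<le> (1 - p) ^ card {..<g}"
    unfolding X1_def
  proof (rule U.prob_all_cells_fail_le[where W = "{..g}" and C = C, OF _ _ _ _ _ _ _ Ds succ])
    have "C b \<inter> C b' = {}" if "b < b'" "b' \<le> g" for b b'
    proof (cases "b' < g")
      case True
      then show ?thesis
        using Bdisj[OF that(1)] that by (simp add: C_def)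
    next
      case False
      then show ?thesis
        using that by (auto simp: C_def)
    qed
    then show "disjoint_family_on C {..g}"
      unfolding disjoint_family_on_def by (metis Int_commute atMost_iff linorder_neqE_nat)
    show "(\<Union>b\<in>{..g}. C b) = space ?\<mu>"
    proof -
      have "y \<in> (\<Union>b\<in>{..g}. C b)" for y
      proof (cases "y \<in> (\<Union>j<g. B j)")
        case True
        then obtain j where "j < g" "y \<in> B j"
          by blast
        then show ?thesis
          by (intro UN_I[of j]) (auto simp: C_def)
      next
        case False
        then show ?thesis
          by (intro UN_I[of g]) (auto simp: C_def)
      qed
      then show ?thesis
        by auto
    qed
  qed (use Cs \<open>p \<le> 1\<close> in auto)
  moreover have "P.prob X2 \<le> (\<Sum>j\<in>{..<g}. P.prob (?few j))"
    unfolding X2_def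
  proof (rule P.finite_measure_subadditive_finite)
    show "?few ` {..<g} \<subseteq> sets ?P"
      using fewS by blast
  qed simp
  moreover have "(\<Sum>j\<in>{..<g}. P.prob (?few j)) \<le> (\<Sum>j\<in>{..<g}. m * (1 - \<beta>) ^ l)"
  proof (rule sum_mono)
    fix j assume "j \<in> {..<g}"
    then have Cj: "U.prob (C j) = \<beta>"
      using mB by (simp add: C_def)
    show "P.prob (?few j) \<le> m * (1 - \<beta>) ^ l"
      using U.prob_few_points_le[OF Cs[of j] \<open>m * l \<le> n\<close>] unfolding Cj .
  qed
  ultimately show "measure (vertex_positions n :: (nat \<Rightarrow> real ^ 'd) measure)
      {x \<in> space (vertex_positions n). nn_tree_max_degree n x < K}
    \<le> (1 - p) ^ g + g * (m * (1 - \<beta>) ^ l)"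
    using split by (simp add: Peq)
qed

section \<open>The upper bound for fixed size\<close>

lemma max_degree_attained:
  assumes "n > 0"
  obtains v where "v < n" "nn_tree_max_degree n x = vertex_degree (nn_tree_edges n x) v"
proof -
  have "nn_tree_max_degree n x \<in> vertex_degree (nn_tree_edges n x) ` {..<n}"
    unfolding nn_tree_max_degree_def max_degree_def using assms by (intro Max_in) auto
  then show ?thesis
    using that by auto
qed

lemma sets_torus_ball: "{y :: real ^ 'd. torus_dist s y c < \<rho>} \<in> sets borel"
proof -
  have [measurable]: "(\<lambda>y :: real ^ 'd. torus_dist s y c) \<in> borel_measurable borel"
    by (intro measurable_torus_dist) auto
  show ?thesis
    by measurable
qed

text \<open>Within the fundamental cell the torus ball is covered by Euclidean balls around the
  translates of \<open>c\<close> by \<open>s\<close> times a vector with entries in -1, 0, 1, which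
  are \<open>3 ^ CARD('d)\<close> in number.\<close>

lemma measure_torus_ball_le:
  fixes c :: "real ^ 'd"
  assumes s: "0 < s" and \<rho>: "0 < \<rho>" "\<rho> \<le> s" and c: "\<And>i. 0 \<le> c $ i" "\<And>i. c $ i \<le> s"
  shows "measure (uniform_measure lborel (torus_cell s)) {y. torus_dist s y c < \<rho>}
    \<le> 3 ^ CARD('d) * measure lborel (ball (0 :: real ^ 'd) 1) * \<rho> ^ CARD('d) / s ^ CARD('d)"
proof -
  let ?B = "{y. torus_dist s y c < \<rho>}"
  let ?K = "(UNIV :: 'd set) \<rightarrow>\<^sub>E {-1..1 :: int}"
  let ?ctr = "\<lambda>k. c + s *\<^sub>R (\<chi> i. of_int (k i)) :: real ^ 'd"
  have sub: "torus_cell s \<inter> ?B \<subseteq> (\<Union>k\<in>?K. ball (?ctr k) \<rho>)"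
  proof
    fix y assume y: "y \<in> torus_cell s \<inter> ?B"
    obtain l where l: "l \<in> torus_lattice s" "torus_dist s y c = norm (y - c - l)"
      using torus_dist_attained[OF s] .
    obtain k' where k': "\<forall>i. k' $ i \<in> \<int>" "l = s *\<^sub>R k'"
      using l(1) torus_lattice_iff by blast
    define k where "k i = \<lfloor>k' $ i\<rfloor>" for i
    have k: "of_int (k i) = k' $ i" for i
      using k'(1) by (simp add: k_def)
    have "k i \<in> {-1..1}" for i
    proof -
      have "\<bar>(y - c - l) $ i\<bar> < \<rho>"
        using component_le_norm_cart[of "y - c - l" i] l(2) y by auto
      moreover have "\<bar>y $ i - c $ i\<bar> \<le> s"
        using y c[of i] by (auto simp: torus_cell_def abs_le_iff intro: order_trans[OF _ less_imp_le]) (smt (verit))+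
      moreover have "(y - c - l) $ i = y $ i - c $ i - s * k' $ i"
        by (simp add: k'(2))
      ultimately have "\<bar>s * k' $ i\<bar> < s * 2"
        using \<rho> by linarith
      \<comment> \<open>Both the displacement between the two points and the radius contribute at
        most \<open>s\<close> per coordinate, the radius strictly bounding its part.\<close>
      then have "\<bar>k' $ i\<bar> < 2"
        using s by (simp add: abs_mult)
      then have "\<bar>of_int (k i) :: real\<bar> < of_int 2"
        by (simp add: k)
      then show ?thesis
        by auto
    qed
    then have "k \<in> ?K"
      by auto
    moreover have "y \<in> ball (?ctr k) \<rho>"
      using y l(2) k' by (simp add: k dist_norm norm_minus_commute algebra_simps)
    ultimately show "y \<in> (\<Union>k\<in>?K. ball (?ctr k) \<rho>)"
      by blast
  qed
  have finK: "finite ?K"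
    by (intro finite_PiE) auto
  have fm: "ball (?ctr k) \<rho> \<in> fmeasurable lborel" for k
    using emeasure_lborel_ball_finite by (auto simp: fmeasurable_def)
  have "measure lborel (torus_cell s \<inter> ?B) \<le> measure lborel (\<Union>k\<in>?K. ball (?ctr k) \<rho>)"
    using sub finK fm sets_torus_ball by (intro measure_mono_fmeasurable fmeasurable.finite_UN) auto
  also have "\<dots> \<le> (\<Sum>k\<in>?K. measure lborel (ball (?ctr k) \<rho>))"
    using finK fm by (intro measure_UNION_le) auto
  also have "\<dots> = (\<Sum>k\<in>?K. \<rho> ^ CARD('d) * measure lborel (ball (0 :: real ^ 'd) 1))"
    using content_ball_conv_unit_ball[of \<rho>, where 'a = "real ^ 'd"] \<rho> by simp
  also have "\<dots> = 3 ^ CARD('d) * measure lborel (ball (0 :: real ^ 'd) 1) * \<rho> ^ CARD('d)"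
    by (simp add: card_funcsetE)
  finally show ?thesis
    using s by (simp add: measure_uniform_torus_cell sets_torus_ball divide_right_mono)
qed

text \<open>With \<open>r = 1 / n\<close>, the children at distance at least \<open>r\<close> number
  at most the logarithmic term deterministically. The nearer ones lie in a small ball around the
  parent. Rounding the parent to a grid of mesh \<open>1 / n\<close> leaves finitely many balls, so
  a union bound shows that \<open>m\<close> vertices in one of them are unlikely.\<close>

lemma prob_high_degree_le:
  fixes n m d :: nat and C :: real
  defines "d \<equiv> CARD('d)"
  defines "C \<equiv> 3 ^ d * measure lborel (ball (0 :: real ^ 'd) 1) * (1 + d) ^ d"
  assumes n: "1 + d \<le> n"
  shows "measure (vertex_positions n :: (nat \<Rightarrow> real ^ 'd) measure)
      {x \<in> space (vertex_positions n).
        1 + (log 2 (d * torus_side TYPE('d) n * n) + 2) * (4 * d) ^ d + m < nn_tree_max_degree n x}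
    \<le> (2 * real n ^ 2) ^ d * (C / n) ^ m"
proof -
  define s where "s = torus_side TYPE('d) n"
  have "d > 0"
    by (simp add: d_def)
  have "n > 0"
    using n by simp
  then have s: "s > 0" "s ^ d = n"
    using torus_side_pos torus_side_power by (auto simp: s_def d_def)
  have s1: "1 \<le> s" "s \<le> n"
  proof -
    show "1 \<le> s"
      using \<open>n > 0\<close> by (auto simp: s_def torus_side_def intro!: ge_one_powr_ge_zero)
    have "s \<le> s ^ d"
      using \<open>1 \<le> s\<close> \<open>d > 0\<close> by (intro self_le_power) auto
    then show "s \<le> n"
      by (simp add: s(2))
  qed
  define r where "r = 1 / real n"
  \<comment> \<open>The radius is \<open>r\<close> for a near child plus \<open>d * r\<close> for
    rounding its parent to the grid, one mesh width per coordinate. The assumption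
    \<open>1 + d \<le> n\<close> makes it at most 1, hence at most \<open>s\<close>.\<close>
  define \<rho> where "\<rho> = (1 + real d) / n"
  have r: "0 < r"
    using \<open>n > 0\<close> by (simp add: r_def)
  have \<rho>: "0 < \<rho>" "\<rho> \<le> s" "\<rho> = r + d * r"
  proof -
    have "\<rho> \<le> 1"
      using n by (simp add: \<rho>_def divide_le_eq_1)
    then show "\<rho> \<le> s"
      using s1 by linarith
  qed (auto simp: \<rho>_def r_def add_divide_distrib \<open>n > 0\<close> intro!: divide_pos_pos add_pos_nonneg)
  let ?\<mu> = "uniform_measure lborel (torus_cell s :: (real ^ 'd) set)"
  interpret U: prob_space ?\<mu>
    by (rule prob_space_uniform_torus_cell[OF s(1)])
  let ?P = "PiM {..<n} (\<lambda>_. ?\<mu>)"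
  interpret P: product_prob_space "\<lambda>_. ?\<mu>" "{..<n}"
    by unfold_locales
  have Peq: "vertex_positions n = ?P"
    by (simp add: vertex_positions_def s_def)
  define N where "N = nat \<lfloor>s * n\<rfloor>"
  define Z where "Z = (UNIV :: 'd set) \<rightarrow>\<^sub>E {..N}"
  define pt :: "('d \<Rightarrow> nat) \<Rightarrow> real ^ 'd" where "pt z = (\<chi> i. real (z i) / n)" for z
  define B where "B z = {y. torus_dist s y (pt z) < \<rho>}" for z
  define \<theta> where "\<theta> = C / real n ^ 2"
  have ptc: "0 \<le> pt z $ i" "pt z $ i \<le> s" if "z \<in> Z" for z i
  proof -
    have "z i \<le> N"
      using that by (auto simp: Z_def)
    then have "real (z i) \<le> s * n"
      using s(1) unfolding N_def by (simp add: le_nat_floor le_floor_iff nat_le_iff le_nat_iff)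
    then show "0 \<le> pt z $ i" "pt z $ i \<le> s"
      using \<open>n > 0\<close> by (auto simp: pt_def divide_le_eq)
  qed
  have Bs: "B z \<in> sets ?\<mu>" for z
    using sets_torus_ball by (simp add: B_def)
  have C0: "0 \<le> C"
    by (simp add: C_def)
  have B\<theta>: "U.prob (B z) \<le> \<theta>" if "z \<in> Z" for z
  proof -
    have "U.prob (B z) \<le> 3 ^ d * measure lborel (ball (0 :: real ^ 'd) 1) * \<rho> ^ d / n"
      using measure_torus_ball_le[OF s(1) \<rho>(1,2), of "pt z"] ptc[OF that] s(2) by (simp add: B_def d_def)
    also have "\<dots> = C / (real n ^ d * n)"
      by (simp add: C_def \<rho>_def power_divide)
    \<comment> \<open>Since \<open>d \<ge> 1\<close>, \<open>n \<le> n ^ d\<close>; the weaker bound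
      suffices, because the expected number of vertices in one ball is then at most
      \<open>C / n\<close>.\<close>
    also have "\<dots> \<le> C / (real n * n)"
      using \<open>n > 0\<close> \<open>d > 0\<close> C0 by (intro divide_left_mono mult_right_mono self_le_power) auto
    finally show ?thesis
      by (simp add: \<theta>_def power2_eq_square)
  qed
  have finZ: "finite Z"
    unfolding Z_def by (intro finite_PiE) auto
  let ?clu = "{x \<in> space ?P. \<exists>z\<in>Z. m \<le> card {i \<in> {..<n}. x i \<in> B z}}"
  let ?cell = "{x \<in> space ?P. \<forall>i\<in>{..<n}. x i \<in> torus_cell s}"
  define bd where "bd = 1 + (log 2 (d * s * n) + 2) * (4 * d) ^ d + m"
  have clu: "P.prob ?clu \<le> (2 * real n ^ 2) ^ d * (C / n) ^ m"
  proof -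
    have "P.prob ?clu \<le> card Z * (card {..<n} * \<theta>) ^ m"
      using Bs B\<theta> finZ C0 by (intro U.prob_cluster_le) (auto simp: \<theta>_def)
    also have "card {..<n} * \<theta> = C / n"
      using \<open>n > 0\<close> by (simp add: \<theta>_def power2_eq_square)
    also have "card Z * (C / n) ^ m \<le> (2 * real n ^ 2) ^ d * (C / n) ^ m"
    proof (intro mult_right_mono)
      \<comment> \<open>There are \<open>N + 1\<close> grid values per axis, and
        \<open>s \<le> n\<close> makes their number at most \<open>2 * n ^ 2\<close>.\<close>
      have "real N \<le> s * n"
        using s(1) by (simp add: N_def)
      also have "\<dots> \<le> real n ^ 2"
        using s1 by (simp add: power2_eq_square mult_right_mono)
      finally have "real N \<le> real n ^ 2" .
      moreover have "1 \<le> real n ^ 2"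
        using \<open>n > 0\<close> by (intro one_le_power) auto
      ultimately have "real (Suc N) \<le> 2 * real n ^ 2"
        unfolding of_nat_Suc by linarith
      then have "real (Suc N) ^ d \<le> (2 * real n ^ 2) ^ d"
        by (intro power_mono) auto
      moreover have "real (card Z) = real (Suc N) ^ d"
        unfolding Z_def d_def by (subst card_funcsetE) auto
      ultimately show "real (card Z) \<le> (2 * real n ^ 2) ^ d"
        by simp
    qed (use C0 in auto)
    finally show ?thesis .
  qed
  have det: "real (nn_tree_max_degree n x) \<le> bd" if x: "x \<in> ?cell" "x \<notin> ?clu" for x
  proof -
    obtain v where v: "v < n" "nn_tree_max_degree n x = vertex_degree (nn_tree_edges n x) v"
      using max_degree_attained[OF \<open>n > 0\<close>] .
    have cell: "x i \<in> torus_cell s" if "i < n" for i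
      using x(1) that by auto
    let ?far = "{i \<in> nn_children n x v. r \<le> torus_dist s (x i) (x v)}"
    let ?near = "{i \<in> nn_children n x v. torus_dist s (x i) (x v) < r}"
    have "r \<le> 1"
      using \<open>n > 0\<close> by (simp add: r_def)
    moreover have "1 * 1 \<le> real d * s"
      using s1 \<open>d > 0\<close> by (intro mult_mono) auto
    ultimately have rs: "r \<le> real d * s"
      by linarith
    have far: "card ?far \<le> (log 2 (d * s * n) + 2) * (4 * d) ^ d"
      using card_far_children_le[OF s(1)[unfolded s_def] r v(1) cell[unfolded s_def]] rs
      by (simp add: s_def d_def r_def)
    define z where "z = (\<lambda>i. nat \<lfloor>x v $ i * n\<rfloor>)"
    have xv: "0 \<le> x v $ i" "x v $ i < s" for i
      using cell[OF v(1)] by (auto simp: torus_cell_def)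
    have "z \<in> Z"
      using xv unfolding Z_def z_def N_def
      by (auto intro!: nat_mono floor_mono mult_right_mono simp: less_imp_le)
    have "norm (x v - pt z) \<le> (\<Sum>i\<in>UNIV. \<bar>(x v - pt z) $ i\<bar>)"
      by (rule norm_le_l1_cart)
    also have "\<dots> \<le> (\<Sum>i\<in>(UNIV :: 'd set). r)"
    proof (rule sum_mono)
      fix i
      have "real (z i) = of_int \<lfloor>x v $ i * n\<rfloor>"
        using xv by (simp add: z_def)
      then have "\<bar>x v $ i * n - real (z i)\<bar> \<le> 1"
        by linarith
      moreover have "(x v - pt z) $ i = (x v $ i * n - real (z i)) / n"
        using \<open>n > 0\<close> by (simp add: pt_def diff_divide_distrib)
      ultimately show "\<bar>(x v - pt z) $ i\<bar> \<le> r"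
        using \<open>n > 0\<close> by (simp add: r_def divide_right_mono)
    qed
    also have "\<dots> = d * r"
      by (simp add: d_def)
    finally have zv: "norm (x v - pt z) \<le> d * r" .
    have "?near \<subseteq> {i \<in> {..<n}. x i \<in> B z}"
    proof
      fix i assume i: "i \<in> ?near"
      have "torus_dist s (x i) (pt z) \<le> torus_dist s (x i) (x v) + dist (x i - pt z) (x i - x v)"
        unfolding torus_dist_eq_infdist by (rule infdist_triangle)
      also have "dist (x i - pt z) (x i - x v) = norm (x v - pt z)"
        by (simp add: dist_norm)
      finally have "torus_dist s (x i) (pt z) < r + d * r"
        using i zv by auto
      then show "i \<in> {i \<in> {..<n}. x i \<in> B z}"
        using i \<rho>(3) by (auto simp: B_def nn_children_def)
    qed
    then have "card ?near \<le> card {i \<in> {..<n}. x i \<in> B z}"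
      by (intro card_mono) auto
    also have "\<dots> < m"
      using x \<open>z \<in> Z\<close> by (auto simp: not_le)
    finally have near: "card ?near < m" .
    have "nn_children n x v = ?far \<union> ?near"
      by (auto simp: not_le)
    from arg_cong[where f = card, OF this]
    have "card (nn_children n x v) \<le> card ?far + card ?near"
      using card_Un_le[of ?far ?near] by linarith
    then have "real (vertex_degree (nn_tree_edges n x) v) \<le> 1 + real (card ?far) + real m"
      using vertex_degree_le_children[of n x v] near by linarith
    then show ?thesis
      using far by (simp add: v(2) bd_def)
  qed
  have cellS: "?cell \<in> sets ?P"
    by (intro U.sets_PiM_Collect_const) auto
  have cluS: "?clu \<in> sets ?P"
    by (intro sets.sets_Collect_finite_Ex sets_Collect_card_PiM finZ Bs) simp
  have cell1: "P.prob ?cell = 1"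
    using prob_all_in_torus_cell[OF \<open>0 < n\<close>, where 'd = 'd] by (simp add: Peq s_def[symmetric])
  have cell0: "P.prob (space ?P - ?cell) = 0"
    unfolding P.P.prob_compl[OF cellS] cell1 by simp
  have "P.prob {x \<in> space ?P. bd < nn_tree_max_degree n x} \<le> P.prob (?clu \<union> (space ?P - ?cell))"
  proof (rule P.finite_measure_mono)
    show "{x \<in> space ?P. bd < nn_tree_max_degree n x} \<subseteq> ?clu \<union> (space ?P - ?cell)"
    proof
      fix x assume "x \<in> {x \<in> space ?P. bd < nn_tree_max_degree n x}"
      then show "x \<in> ?clu \<union> (space ?P - ?cell)"
        using det[of x] not_less by blast
    qed
    show "?clu \<union> (space ?P - ?cell) \<in> sets ?P"
      by (intro sets.Un cluS sets.Diff sets.top cellS)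
  qed
  also have "\<dots> \<le> P.prob ?clu + P.prob (space ?P - ?cell)"
    by (intro measure_Un_le cluS sets.Diff sets.top cellS)
  also have "\<dots> \<le> (2 * real n ^ 2) ^ d * (C / n) ^ m"
    using clu unfolding cell0 by simp
  finally show ?thesis
    by (simp add: Peq bd_def s_def)
qed

section \<open>Asymptotics\<close>

lemma sum_power_le_power:
  fixes L :: nat
  assumes "2 \<le> L"
  shows "(\<Sum>k<K. L ^ k) \<le> L ^ K"
proof (induction K)
  case (Suc K)
  then have "(\<Sum>k<Suc K. L ^ k) \<le> 2 * L ^ K"
    by simp
  also have "\<dots> \<le> L ^ Suc K"
    using assms by simp
  finally show ?case .
qed simp

text \<open>The exponent is of order \<open>- (n powr \<tau>)\<close>, which beats every multiple of
  \<open>ln n\<close>.\<close>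

lemma exp_neg_powr_eventually_le:
  fixes \<tau> L A :: real
  assumes "\<tau> > 0" "L > 0"
  shows "\<forall>\<^sub>F n in sequentially. exp (- (real n powr (- \<tau>) / L * (real n powr (2 * \<tau>) - 1))) \<le> real n powr (- A) / 4"
  using assms by real_asymp

text \<open>The exponent is of order \<open>- (n powr (3 / 4 - \<tau>))\<close>, a positive power
  since \<open>\<tau> \<le> 1 / 8\<close>, and beats the polynomial prefactor.\<close>

lemma powr_mult_exp_neg_eventually_le:
  fixes \<tau> L A c :: real
  assumes "0 < \<tau>" "\<tau> \<le> 1 / 8" "L > 0" "c > 0"
  shows "\<forall>\<^sub>F n in sequentially. real n powr (2 * \<tau>) * (L * real n powr \<tau>) *
    exp (- (c * real n powr (- 1 / 4) * (real n powr (1 - \<tau>) / L - 1))) \<le> real n powr (- A) / 4"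
  using assms by real_asymp

text \<open>The term \<open>- (ln n)\<^sup>2\<close> dominates the exponent, so the decay is faster
  than any power of \<open>n\<close>.\<close>

lemma exp_neg_ln_square_eventually_le:
  fixes A C D :: real
  shows "\<forall>\<^sub>F n in sequentially. exp (D * (ln 2 + 2 * ln (real n)) + ln (real n) * (C - ln (real n))) \<le> real n powr (- A) / 2"
  by real_asymp

text \<open>Take \<open>K\<close> about \<open>a0 * ln n\<close> levels and \<open>g\<close> about
  \<open>n powr (2 * \<tau>)\<close> balls. Each pattern has probability at least of order
  \<open>n powr (- \<tau>)\<close>, so about \<open>n powr \<tau>\<close> successes are expected. A
  ball keeps probability at least of order \<open>n powr (- 1 / 4)\<close> while \<open>m\<close> is
  at most of order \<open>n powr \<tau>\<close>, so every ball is filled with overwhelming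
  probability.\<close>

lemma low_degree_eventually:
  obtains a :: real where "0 < a"
    "\<And>A. \<forall>\<^sub>F n in sequentially.
      measure (vertex_positions n :: (nat \<Rightarrow> real ^ 'd) measure)
        {x \<in> space (vertex_positions n). real (nn_tree_max_degree n x) < a * ln (real n)} \<le> real n powr (- A) / 2"
proof -
  define d where "d = CARD('d)"
  have "d > 0"
    by (simp add: d_def)
  define \<omega> where "\<omega> = measure lborel (ball (0 :: real ^ 'd) 1)"
  have "\<omega> > 0"
    unfolding \<omega>_def by (rule content_ball_pos) simp
  define L where "L = (8 :: real) ^ d"
  define \<sigma> where "\<sigma> = ((1 / 4) ^ d - (1 / 8) ^ d) * exp (- 1 :: real)"
  \<comment> \<open>One further level costs the factor \<open>q\<close>: the pattern probability is
    \<open>q ^ K / L\<close>.\<close>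
  define q where "q = \<sigma> / L"
  \<comment> \<open>Chosen so that \<open>g ^ d\<close> is at most
    \<open>n powr (1 / 4)\<close>.\<close>
  define \<tau> where "\<tau> = 1 / (8 * real d)"
  have "L \<ge> 8"
    using \<open>d > 0\<close> self_le_power[of "8::real" d] by (simp add: L_def)
  then have "L > 0"
    by linarith
  have \<tau>: "0 < \<tau>" "\<tau> \<le> 1 / 8"
    using \<open>d > 0\<close> by (auto simp: \<tau>_def field_simps)
  have \<sigma>: "0 < \<sigma>" "\<sigma> \<le> 1"
  proof -
    have "(1 / 8 :: real) ^ d < (1 / 4) ^ d" "(1 / 4 :: real) ^ d \<le> 1" "(0 :: real) \<le> (1 / 8) ^ d"
      using \<open>d > 0\<close> by (auto intro!: power_strict_mono power_le_one)
    then have "0 < (1 / 4 :: real) ^ d - (1 / 8) ^ d" "(1 / 4 :: real) ^ d - (1 / 8) ^ d \<le> 1"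
      by linarith+
    then show "0 < \<sigma>" "\<sigma> \<le> 1"
      unfolding \<sigma>_def by (auto intro: mult_le_one simp del: diff_gt_0_iff_gt)
  qed
  have q: "0 < q" "q \<le> 1 / L" "q < 1"
    using \<sigma> \<open>L \<ge> 8\<close> by (auto simp: q_def divide_right_mono divide_less_eq)
  \<comment> \<open>Chosen so that \<open>q ^ K\<close> is at least \<open>n powr (- \<tau>)\<close>
    whenever \<open>K \<le> a0 * ln n\<close>.\<close>
  define a0 where "a0 = \<tau> / ln (1 / q)"
  have lnq: "0 < ln (1 / q)"
    using q by (intro ln_gt_zero) (simp add: less_divide_eq)
  then have "a0 > 0"
    using \<tau> by (simp add: a0_def)
  define c where "c = \<omega> * (1 / 2) ^ d"
  have "c > 0"
    using \<open>\<omega> > 0\<close> by (simp add: c_def)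
  \<comment> \<open>Halving \<open>a0\<close> absorbs the rounding in \<open>K\<close> as soon as
    \<open>ln n \<ge> 2 / a0\<close>.\<close>
  show ?thesis
  proof (rule that[of "a0 / 2"])
    show "0 < a0 / 2"
      using \<open>a0 > 0\<close> by simp
    fix A :: real
    have "\<forall>\<^sub>F n in sequentially. 2 / a0 \<le> ln (real n)"
      by real_asymp
    then show "\<forall>\<^sub>F n in sequentially.
      measure (vertex_positions n :: (nat \<Rightarrow> real ^ 'd) measure)
        {x \<in> space (vertex_positions n). real (nn_tree_max_degree n x) < a0 / 2 * ln (real n)}
        \<le> real n powr (- A) / 2"
      using exp_neg_powr_eventually_le[OF \<tau>(1) \<open>L > 0\<close>, of A]
        powr_mult_exp_neg_eventually_le[OF \<tau> \<open>L > 0\<close> \<open>c > 0\<close>, of A] eventually_gt_at_top[of 0]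
    proof eventually_elim
      case (elim n)
      define K where "K = nat \<lfloor>a0 * ln (real n)\<rfloor>"
      define g where "g = nat \<lfloor>real n powr (2 * \<tau>)\<rfloor>"
      define m where "m = (\<Sum>k<Suc K. (8 ^ d) ^ k :: nat)"
      define l where "l = n div m"
      define p where "p = (1 / 8 ^ Suc K) ^ d * \<sigma> ^ K"
      define \<beta> where "\<beta> = \<omega> * (1 / real (2 * g)) ^ d"
      have n1: "1 \<le> real n"
        using \<open>0 < n\<close> by simp
      have g: "real g \<le> real n powr (2 * \<tau>)" "real n powr (2 * \<tau>) - 1 \<le> real g" "0 < g"
      proof -
        have "1 \<le> real n powr (2 * \<tau>)"
          using n1 \<tau> by (intro ge_one_powr_ge_zero) auto
        then show "real g \<le> real n powr (2 * \<tau>)" "real n powr (2 * \<tau>) - 1 \<le> real g" "0 < g"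
          unfolding g_def by linarith+
      qed
      have Kn: "real K \<le> a0 * ln (real n)" "a0 * ln (real n) - 1 \<le> real K"
        using \<open>a0 > 0\<close> n1 unfolding K_def by (auto simp: ln_ge_zero)
      have Kge: "a0 / 2 * ln (real n) \<le> real K"
        using Kn(2) elim(1) \<open>a0 > 0\<close> by (simp add: field_simps)
      have qK: "(1 / q) ^ K \<le> real n powr \<tau>"
      proof -
        have "(1 / q) ^ K = exp (K * ln (1 / q))"
          using q by (simp add: exp_of_nat_mult)
        also have "\<dots> \<le> exp (a0 * ln (real n) * ln (1 / q))"
          using Kn(1) lnq by (simp add: mult_right_mono)
        also have "a0 * ln (real n) * ln (1 / q) = \<tau> * ln (real n)"
          using lnq by (simp add: a0_def)
        also have "exp (\<tau> * ln (real n)) = real n powr \<tau>"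
          using n1 by (simp add: powr_def)
        finally show ?thesis .
      qed
      have p: "real n powr (- \<tau>) / L \<le> p"
      proof -
        have "real n powr (- \<tau>) = 1 / real n powr \<tau>"
          by (simp add: powr_minus_divide)
        also have "\<dots> \<le> 1 / (1 / q) ^ K"
          using qK q n1 by (intro divide_left_mono mult_pos_pos) auto
        also have "\<dots> = q ^ K"
          by (simp add: power_one_over)
        finally have "real n powr (- \<tau>) / L \<le> q ^ K / L"
          using \<open>L > 0\<close> by (simp add: divide_right_mono)
        also have "\<dots> = p"
          by (simp add: p_def q_def L_def power_divide flip: power_mult)
        finally show ?thesis .
      qed
      have m: "real m \<le> L * real n powr \<tau>"
      proof -
        have "m \<le> (8 ^ d) ^ Suc K"
          unfolding m_def using self_le_power[of "8::nat" d] \<open>d > 0\<close> by (intro sum_power_le_power) auto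
        then have "real m \<le> L ^ Suc K"
          by (metis L_def of_nat_le_iff of_nat_numeral of_nat_power)
        also have "L ^ Suc K \<le> L * (1 / q) ^ K"
        proof -
          \<comment> \<open>Since \<open>\<sigma> \<le> 1\<close>, the growth factor of the blocks
            is at most \<open>1 / q\<close>, so \<open>qK\<close> also controls
            \<open>m\<close>.\<close>
          have "L \<le> 1 / q"
            using q \<open>L > 0\<close> by (simp add: field_simps)
          then have "L ^ K \<le> (1 / q) ^ K"
            using \<open>L > 0\<close> by (intro power_mono) auto
          then show ?thesis
            using \<open>L > 0\<close> by simp
        qed
        also have "\<dots> \<le> L * real n powr \<tau>"
          using qK \<open>L > 0\<close> by simp
        finally show ?thesis .
      qed
      have "m > 0"
        unfolding m_def by (simp add: sum.lessThan_Suc_shift del: sum.lessThan_Suc)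
      have l: "real n powr (1 - \<tau>) / L - 1 \<le> real l"
      proof -
        have "real n powr (1 - \<tau>) / L = real n / (L * real n powr \<tau>)"
          using n1 by (simp add: powr_diff)
        also have "\<dots> \<le> real n / real m"
          using m \<open>m > 0\<close> \<open>L > 0\<close> n1 by (intro divide_left_mono mult_pos_pos) auto
        also have "\<dots> \<le> real l + 1"
          using floor_divide_of_nat_eq[of n m, where 'a = real] unfolding l_def by linarith
        finally show ?thesis
          by linarith
      qed
      have \<beta>: "c * real n powr (- 1 / 4) \<le> \<beta>"
      proof -
        have "real n powr (- 1 / 4) = (1 / real n powr (2 * \<tau>)) ^ d"
          using n1 \<open>d > 0\<close> by (simp add: \<tau>_def power_one_over powr_minus_divide powr_powr flip: powr_realpow)
        also have "\<dots> \<le> (1 / real g) ^ d"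
          using g n1 by (intro power_mono divide_left_mono mult_pos_pos) auto
        finally have "c * real n powr (- 1 / 4) \<le> c * (1 / real g) ^ d"
          using \<open>c > 0\<close> by (intro mult_left_mono) auto
        also have "\<dots> = \<beta>"
          by (simp add: \<beta>_def c_def power_divide power_mult_distrib)
        finally show ?thesis .
      qed
      have "m * l \<le> n"
        by (simp add: l_def)
      note low = prob_low_degree_le[where 'd = 'd, OF \<open>0 < n\<close> \<open>0 < g\<close> this[unfolded m_def d_def],
          folded d_def, folded \<omega>_def \<sigma>_def, folded \<beta>_def p_def m_def]
      have "measure (vertex_positions n :: (nat \<Rightarrow> real ^ 'd) measure)
          {x \<in> space (vertex_positions n). real (nn_tree_max_degree n x) < a0 / 2 * ln (real n)}
        \<le> measure (vertex_positions n :: (nat \<Rightarrow> real ^ 'd) measure)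
          {x \<in> space (vertex_positions n). nn_tree_max_degree n x < K}"
      proof -
        let ?s = "torus_side TYPE('d) n"
        let ?\<mu> = "uniform_measure lborel (torus_cell ?s :: (real ^ 'd) set)"
        interpret U: prob_space ?\<mu>
          by (rule prob_space_uniform_torus_cell[OF torus_side_pos[OF \<open>0 < n\<close>]])
        interpret P: product_prob_space "\<lambda>_. ?\<mu>" "{..<n}"
          by unfold_locales
        show ?thesis
          unfolding vertex_positions_def
        proof (rule P.finite_measure_mono)
          show "{x \<in> space (PiM {..<n} (\<lambda>_. ?\<mu>)). nn_tree_max_degree n x < K} \<in> sets (PiM {..<n} (\<lambda>_. ?\<mu>))"
            by (rule sets_Collect_max_degree) simp
        qed (use Kge in auto)
      qed
      also have "\<dots> \<le> (1 - p) ^ g + real g * (real m * (1 - \<beta>) ^ l)"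
        using low(1) by simp
      also have "\<dots> \<le> real n powr (- A) / 4 + real n powr (- A) / 4"
      proof (rule add_mono)
        have "(1 - p) ^ g \<le> exp (- p) ^ g"
          using low(3) exp_ge_add_one_self[of "- p"] by (intro power_mono) auto
        also have "\<dots> = exp (- (p * real g))"
          by (simp add: mult.commute flip: exp_of_nat_mult)
        also have "\<dots> \<le> exp (- (real n powr (- \<tau>) / L * (real n powr (2 * \<tau>) - 1)))"
        proof -
          have "real n powr (- \<tau>) / L * (real n powr (2 * \<tau>) - 1) \<le> real n powr (- \<tau>) / L * real g"
            using g(2) \<open>L > 0\<close> by (intro mult_left_mono) auto
          also have "\<dots> \<le> p * real g"
            using p by (intro mult_right_mono) auto
          finally show ?thesis
            by simp
        qed
        also note elim(2)
        finally show "(1 - p) ^ g \<le> real n powr (- A) / 4" .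
        have "(1 - \<beta>) ^ l \<le> exp (- \<beta>) ^ l"
          using low(2) exp_ge_add_one_self[of "- \<beta>"] by (intro power_mono) auto
        also have "\<dots> = exp (- (\<beta> * real l))"
          by (simp add: mult.commute flip: exp_of_nat_mult)
        also have "\<dots> \<le> exp (- (c * real n powr (- 1 / 4) * (real n powr (1 - \<tau>) / L - 1)))"
        proof -
          have "c * real n powr (- 1 / 4) * (real n powr (1 - \<tau>) / L - 1) \<le> c * real n powr (- 1 / 4) * real l"
            using l \<open>c > 0\<close> by (intro mult_left_mono) auto
          also have "\<dots> \<le> \<beta> * real l"
            using \<beta> by (intro mult_right_mono) auto
          finally show ?thesis
            by simp
        qed
        finally have "real g * (real m * (1 - \<beta>) ^ l) \<le> real n powr (2 * \<tau>) * (L * real n powr \<tau> *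
            exp (- (c * real n powr (- 1 / 4) * (real n powr (1 - \<tau>) / L - 1))))"
          using g(1) m low(2) \<open>L > 0\<close> by (intro mult_mono) auto
        also have "\<dots> = real n powr (2 * \<tau>) * (L * real n powr \<tau>) *
            exp (- (c * real n powr (- 1 / 4) * (real n powr (1 - \<tau>) / L - 1)))"
          by (simp only: mult.assoc)
        also note elim(3)
        finally show "real g * (real m * (1 - \<beta>) ^ l) \<le> real n powr (- A) / 4" .
      qed
      finally show ?case
        by simp
    qed
  qed
qed

text \<open>With \<open>m\<close> the ceiling of \<open>ln n\<close>, the factor
  \<open>(C / n) ^ m\<close> is of order \<open>exp (- (ln n)\<^sup>2)\<close> up to powers of
  \<open>n\<close>, which outweighs the polynomial number of grid points, while the degree bound
  stays of order \<open>ln n\<close>.\<close>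

lemma high_degree_eventually:
  obtains b :: real where
    "\<And>A. \<forall>\<^sub>F n in sequentially.
      measure (vertex_positions n :: (nat \<Rightarrow> real ^ 'd) measure)
        {x \<in> space (vertex_positions n). b * ln (real n) < real (nn_tree_max_degree n x)} \<le> real n powr (- A) / 2"
proof -
  define d where "d = CARD('d)"
  have "d > 0"
    by (simp add: d_def)
  define C where "C = 3 ^ d * measure lborel (ball (0 :: real ^ 'd) 1) * real (1 + d) ^ d"
  have "C > 0"
    using content_ball_pos[of 1 "0 :: real ^ 'd"] by (auto simp: C_def intro!: mult_pos_pos)
  \<comment> \<open>The 3 covers \<open>1 + m \<le> ln n + 2\<close>. The bracket covers the number
    of scales, using \<open>s \<le> n\<close>. Constants are multiplied by \<open>ln n\<close>,
    which is eventually at least 1.\<close>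
  define b where "b = 3 + (log 2 (real d) + 2 / ln 2 + 2) * (4 * real d) ^ d"
  show ?thesis
  proof (rule that[of b])
    fix A :: real
    have "\<forall>\<^sub>F n in sequentially. 1 \<le> ln (real n)" "\<forall>\<^sub>F n in sequentially. ln C \<le> ln (real n)"
      by real_asymp+
    then show "\<forall>\<^sub>F n in sequentially.
      measure (vertex_positions n :: (nat \<Rightarrow> real ^ 'd) measure)
        {x \<in> space (vertex_positions n). b * ln (real n) < real (nn_tree_max_degree n x)}
        \<le> real n powr (- A) / 2"
      using exp_neg_ln_square_eventually_le[of "real d" "ln C" A] eventually_ge_at_top[of "1 + d"]
    proof eventually_elim
      case (elim n)
      define m where "m = nat \<lceil>ln (real n)\<rceil>"
      define s where "s = torus_side TYPE('d) n"
      define bd where "bd = 1 + (log 2 (d * s * n) + 2) * (4 * real d) ^ d + m"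
      have "n > 0"
        using elim(4) by simp
      have s: "1 \<le> s" "s \<le> n"
      proof -
        show "1 \<le> s"
          using \<open>n > 0\<close> by (auto simp: s_def torus_side_def intro!: ge_one_powr_ge_zero)
        then have "s \<le> s ^ CARD('d)"
          by (intro self_le_power) auto
        then show "s \<le> n"
          using torus_side_power[OF \<open>n > 0\<close>, where 'd = 'd] by (simp add: s_def)
      qed
      have m: "ln (real n) \<le> m" "m \<le> ln (real n) + 1"
        using elim(1) unfolding m_def by linarith+
      have "bd \<le> b * ln (real n)"
      proof -
        have "log 2 (d * s * n) \<le> log 2 (d * real n * n)"
          using s \<open>d > 0\<close> \<open>n > 0\<close> by (subst log_le_cancel_iff) (auto intro!: mult_mono)
        also have "\<dots> = log 2 d + 2 / ln 2 * ln (real n)"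
          using \<open>d > 0\<close> \<open>n > 0\<close> by (simp add: log_def ln_mult add_divide_distrib)
        also have "log 2 d \<le> log 2 d * ln (real n)"
          using \<open>d > 0\<close> elim(1) by (simp add: mult_le_cancel_left1)
        finally have "log 2 (d * s * n) + 2 \<le> (log 2 d + 2 / ln 2 + 2) * ln (real n)"
          using elim(1) unfolding distrib_right by linarith
        then have "(log 2 (d * s * n) + 2) * (4 * real d) ^ d
            \<le> (log 2 d + 2 / ln 2 + 2) * ln (real n) * (4 * real d) ^ d"
          by (intro mult_right_mono) auto
        moreover have "b * ln (real n) = 3 * ln (real n) + (log 2 d + 2 / ln 2 + 2) * ln (real n) * (4 * real d) ^ d"
          by (simp add: b_def algebra_simps)
        ultimately show ?thesis
          using m elim(1) unfolding bd_def by linarith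
      qed
      have "measure (vertex_positions n :: (nat \<Rightarrow> real ^ 'd) measure)
          {x \<in> space (vertex_positions n). b * ln (real n) < real (nn_tree_max_degree n x)}
        \<le> measure (vertex_positions n :: (nat \<Rightarrow> real ^ 'd) measure)
          {x \<in> space (vertex_positions n). bd < real (nn_tree_max_degree n x)}"
      proof -
        let ?\<mu> = "uniform_measure lborel (torus_cell s :: (real ^ 'd) set)"
        interpret U: prob_space ?\<mu>
          using s by (intro prob_space_uniform_torus_cell) auto
        interpret P: product_prob_space "\<lambda>_. ?\<mu>" "{..<n}"
          by unfold_locales
        show ?thesis
          unfolding vertex_positions_def s_def[symmetric]
        proof (rule P.finite_measure_mono)
          show "{x \<in> space (PiM {..<n} (\<lambda>_. ?\<mu>)). bd < real (nn_tree_max_degree n x)} \<in> sets (PiM {..<n} (\<lambda>_. ?\<mu>))"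
            by (rule sets_Collect_max_degree) simp
        qed (use \<open>bd \<le> b * ln (real n)\<close> in auto)
      qed
      also have "\<dots> \<le> (2 * real n ^ 2) ^ d * (C / n) ^ m"
        using prob_high_degree_le[where 'd = 'd and n = n and m = m] elim(4)
        by (simp add: bd_def C_def s_def d_def)
      also have "\<dots> \<le> exp (d * (ln 2 + 2 * ln (real n))) * exp (ln (real n) * (ln C - ln (real n)))"
      proof (rule mult_mono)
        have "(2 * real n ^ 2) ^ d = exp (ln (2 * real n ^ 2)) ^ d"
          using \<open>n > 0\<close> by simp
        also have "\<dots> = exp (d * ln (2 * real n ^ 2))"
          by (simp flip: exp_of_nat_mult)
        also have "ln (2 * real n ^ 2) = ln 2 + 2 * ln (real n)"
          using \<open>n > 0\<close> by (simp add: ln_mult ln_realpow)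
        finally show "(2 * real n ^ 2) ^ d \<le> exp (d * (ln 2 + 2 * ln (real n)))"
          by simp
        have "(C / n) ^ m = exp (ln (C / n)) ^ m"
          using \<open>n > 0\<close> \<open>C > 0\<close> by simp
        also have "\<dots> = exp (m * (ln C - ln (real n)))"
          using \<open>n > 0\<close> \<open>C > 0\<close> by (simp add: ln_div flip: exp_of_nat_mult)
        \<comment> \<open>Eventually \<open>ln C - ln n \<le> 0\<close>, so the lower bound
          \<open>m \<ge> ln n\<close> gives an upper bound here.\<close>
        also have "\<dots> \<le> exp (ln (real n) * (ln C - ln (real n)))"
          using m(1) elim(2) by (simp add: mult_right_mono_neg)
        finally show "(C / n) ^ m \<le> exp (ln (real n) * (ln C - ln (real n)))" .
      qed (use \<open>C > 0\<close> in auto)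
      also have "\<dots> \<le> real n powr (- A) / 2"
        using elim(3) by (simp add: exp_add)
      finally show ?case .
    qed
  qed
qed

theorem theorem1p6:
  "\<exists>a b :: real. 0 < a \<and> a \<le> b \<and>
     (\<forall>A > 0. \<forall>\<^sub>F n in sequentially.
        measure (vertex_positions n :: (nat \<Rightarrow> real ^ 'd) measure)
          {x \<in> space (vertex_positions n).
             a * ln (real n) \<le> real (nn_tree_max_degree n x) \<and>
             real (nn_tree_max_degree n x) \<le> b * ln (real n)}
        \<ge> 1 - real n powr (- A))"
proof -
  obtain a where a: "0 < a" and low: "\<And>A. \<forall>\<^sub>F n in sequentially.
      measure (vertex_positions n :: (nat \<Rightarrow> real ^ 'd) measure)
        {x \<in> space (vertex_positions n). real (nn_tree_max_degree n x) < a * ln (real n)} \<le> real n powr (- A) / 2"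
    using low_degree_eventually[where 'd = 'd] by blast
  obtain b where high: "\<And>A. \<forall>\<^sub>F n in sequentially.
      measure (vertex_positions n :: (nat \<Rightarrow> real ^ 'd) measure)
        {x \<in> space (vertex_positions n). b * ln (real n) < real (nn_tree_max_degree n x)} \<le> real n powr (- A) / 2"
    using high_degree_eventually[where 'd = 'd] by blast
  \<comment> \<open>The maximum secures \<open>a \<le> b'\<close>. As \<open>ln n \<ge> 0\<close>
    for \<open>n \<ge> 1\<close>, a larger constant only weakens the upper bound on the
    degree.\<close>
  define b' where "b' = max a b"
  show ?thesis
  proof (rule exI[of _ a], rule exI[of _ b'], intro conjI allI impI)
    show "0 < a" "a \<le> b'"
      using a by (auto simp: b'_def)
    fix A :: real
    show "\<forall>\<^sub>F n in sequentially.
        measure (vertex_positions n :: (nat \<Rightarrow> real ^ 'd) measure)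
          {x \<in> space (vertex_positions n).
             a * ln (real n) \<le> real (nn_tree_max_degree n x) \<and>
             real (nn_tree_max_degree n x) \<le> b' * ln (real n)}
        \<ge> 1 - real n powr (- A)"
      using low[of A] high[of A] eventually_gt_at_top[of 0]
    proof eventually_elim
      case (elim n)
      let ?\<mu> = "uniform_measure lborel (torus_cell (torus_side TYPE('d) n) :: (real ^ 'd) set)"
      interpret U: prob_space ?\<mu>
        by (rule prob_space_uniform_torus_cell[OF torus_side_pos[OF \<open>0 < n\<close>]])
      interpret P: product_prob_space "\<lambda>_. ?\<mu>" "{..<n}"
        by unfold_locales
      let ?P = "PiM {..<n} (\<lambda>_. ?\<mu>)"
      have S: "{x \<in> space ?P. Q (nn_tree_max_degree n x)} \<in> sets ?P" for Q
        by (rule sets_Collect_max_degree) simp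
      define lo where "lo = {x \<in> space ?P. real (nn_tree_max_degree n x) < a * ln (real n)}"
      define hi where "hi = {x \<in> space ?P. b * ln (real n) < real (nn_tree_max_degree n x)}"
      have sets: "lo \<in> sets ?P" "hi \<in> sets ?P"
        unfolding lo_def hi_def by (rule S)+
      have "P.prob (space ?P - (lo \<union> hi)) = 1 - P.prob (lo \<union> hi)"
        by (rule P.P.prob_compl) (use sets in auto)
      moreover have "P.prob (lo \<union> hi) \<le> P.prob lo + P.prob hi"
        using sets by (intro measure_Un_le)
      moreover have "P.prob lo \<le> real n powr (- A) / 2" "P.prob hi \<le> real n powr (- A) / 2"
        using elim(1,2) unfolding lo_def hi_def vertex_positions_def .
      moreover have "P.prob (space ?P - (lo \<union> hi)) \<le> P.prob {x \<in> space ?P.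
             a * ln (real n) \<le> real (nn_tree_max_degree n x) \<and>
             real (nn_tree_max_degree n x) \<le> b' * ln (real n)}"
      proof (rule P.finite_measure_mono)
        have "b * ln (real n) \<le> b' * ln (real n)"
          using \<open>0 < n\<close> by (intro mult_right_mono) (auto simp: b'_def)
        then show "space ?P - (lo \<union> hi) \<subseteq> {x \<in> space ?P.
             a * ln (real n) \<le> real (nn_tree_max_degree n x) \<and>
             real (nn_tree_max_degree n x) \<le> b' * ln (real n)}"
          unfolding lo_def hi_def by auto
      qed (rule S)
      ultimately show ?case
        unfolding vertex_positions_def by linarith
    qed
  qed
qed

end
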